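(* Let $0<T<+\infty$, let $X,Y$ be real Hilbert spaces, $C\in\mathcal L(X,Y)$, and let $(A(t))_{t\in[0,T]}$ be a family of operators on $X$ with common dense domain $D$ satisfying the standing assumptions of the context, generating the bi-directional evolution system $(\mathbb T(t,s))_{0\le s,t\le T}$. Let $\mu\ge0$, suppose that both $((A(t))_{t\in[0,T]},C)$ and $((-A(t))_{t\in[0,T]},C)$ are $\mu$-weakly detectable, and let $r>\mu$. Let $\mathcal O_T$ be the observable subspace at time $T$ of the pair $(\mathbb T,C)$ and $\Pi_{\mathcal O_T}$ the orthogonal projection of $X$ onto it. Then the back and forth nudging system is a weak back and forth $\mathcal O_T$-observer, i.e. for all $\varepsilon_0\in X$, $$\Pi_{\mathcal O_T}\,\varepsilon^{2n}(0)=\Pi_{\mathcal O_T}\big(\mathbb S_-(0,T)\,\mathbb S_+(T,0)\big)^n\varepsilon_0$$ converges weakly to $0$ in $X$ as $n\to+\infty$.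
   Context: $\mathcal L(X,Y)$ denotes bounded linear operators, $\mathcal L(X)=\mathcal L(X,X)$; $C^*$ is the adjoint of $C$. Standing assumptions: $D\subset X$ is a dense subspace; each of the families $(B(t))_{t\in[0,T]}=(A(t))_{t\in[0,T]}$ and $(B(t))_{t\in[0,T]}=(-A(T-t))_{t\in[0,T]}$ consists of generators $B(t):D\to X$ of strongly continuous semigroups and is stable (in Pazy's sense): there are $M\ge1$, $\omega\in\mathbb R$ with $(\omega,\infty)\subset\rho(B(t))$ and $\|\prod_{j=1}^k(\lambda-B(t_j))^{-1}\|\le M(\lambda-\omega)^{-k}$ for all $\lambda>\omega$ and finite sequences $0\le t_1\le\dots\le t_k\le T$ (time-ordered product); for every $x\in D$, $t\mapsto A(t)x$ is continuously differentiable in $X$. An evolution system $(U(t,s))_{0\le s\le t\le T}$ is a family in $\mathcal L(X)$ with $U(s,s)=\mathrm{Id}$, $U(t,\sigma)U(\sigma,s)=U(t,s)$ for $s\le\sigma\le t$, and $(t,s)\mapsto U(t,s)x$ continuous for all $x$. It is generated by $(B(t))$ if for $x\in D$, $U(t,s)x\in D$, $\partial_tU(t,s)x=B(t)U(t,s)x$ and $\partial_sU(t,s)x=-U(t,s)B(s)x$. A bi-directional evolution system on $X$ over $[0,T]$ is a family $(U(t,s))_{0\le s,t\le T}$ in $\mathcal L(X)$ with $U(t,t)=\mathrm{Id}$, $U(t,s)U(s,\sigma)=U(t,\sigma)$ for all $t,s,\sigma\in[0,T]$, and $U(t,s)x\to x$ as $s\to t$ for all $x\in X$. $(A(t))$ generates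 the bi-directional evolution system $U$ if $(A(t))$ generates the evolution system $(U(t,s))_{0\le s\le t\le T}$, $(-A(T-t))$ generates the evolution system $(U(T-t,T-s))_{0\le s\le t\le T}$, and $U(s,t)U(t,s)=\mathrm{Id}$ for all $s,t$. Then there are $M,\omega>0$ with $\|\mathbb T(t,s)\|\le Me^{\omega|t-s|}$, and $(A(t)-rC^*C)_{t\in[0,T]}$, $(A(t)+rC^*C)_{t\in[0,T]}$ generate bi-directional evolution systems denoted $\mathbb S_+$ and $\mathbb S_-$ respectively. System: $\dot z=A(t)z$, $z(0)=z_0$, $y=Cz$ on $[0,T]$. Back and forth nudging system: for $n\in\mathbb N$, $\dot{\hat z}^{2n}=A(t)\hat z^{2n}-rC^*(C\hat z^{2n}-y)$ with $\hat z^{2n}(0)=\hat z^{2n-1}(0)$ if $n\ge1$, $\hat z^0(0)=\hat z_0$; and $\dot{\hat z}^{2n+1}=A(t)\hat z^{2n+1}+rC^*(C\hat z^{2n+1}-y)$ with $\hat z^{2n+1}(T)=\hat z^{2n}(T)$. The error is $\varepsilon^n=\hat z^n-z$, $\varepsilon_0=\hat z_0-z_0$, and $\varepsilon^{2n}(0)=(\mathbb S_-(0,T)\mathbb S_+(T,0))^n\varepsilon_0$. $((\pm A(t))_{t\in[0,T]},C)$ is $\mu$-weakly detectable if $\pm\langle A(t)x,x\rangle_X\le\mu\|Cx\|_Y^2$ for all $t\in[0,T]$, $x\in D$. $W(0,T)z_0=\int_0^T\mathbb T(t,0)^*C^*C\,\mathbb T(t,0)z_0\,dt$, and the observable subspace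 at time $T$ of $(\mathbb T,C)$ is $\mathcal O_T=(\ker W(0,T))^\perp$. *)

theory Defs
  imports "HOL-Analysis.Analysis"
begin

text \<open>
  Real Hilbert spaces are types of sort \<open>{real_inner, banach}\<close>. An unbounded operator with domain
  \<open>D\<close> is a total function together with the set \<open>D\<close>; its values outside \<open>D\<close> are never used.
  Two-parameter families are total in both time arguments, but only arguments in \<open>[0, T]\<close> (or in
  the triangle \<open>0 \<le> s \<le> t \<le> T\<close>) are constrained.
\<close>

subsection \<open>Semigroups, resolvents, stable families\<close>

definition C0_semigroup :: "(real \<Rightarrow> 'a::banach \<Rightarrow>\<^sub>L 'a) \<Rightarrow> bool" where
  "C0_semigroup S \<longleftrightarrow>
     S 0 = id_blinfun \<and>
     (\<forall>s\<ge>0. \<forall>t\<ge>0. S (s + t) = S s o\<^sub>L S t) \<and>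
     (\<forall>x. ((\<lambda>t. S t x) \<longlongrightarrow> x) (at_right 0))"

text \<open>The equivalence forces \<open>D\<close> to be the full domain of the generator, i.e. the set of all \<open>x\<close>
  for which the difference quotient converges.\<close>

definition generates_C0_semigroup :: "'a::banach set \<Rightarrow> ('a \<Rightarrow> 'a) \<Rightarrow> bool" where
  "generates_C0_semigroup D B \<longleftrightarrow>
     (\<exists>S. C0_semigroup S \<and>
       (\<forall>x y. ((\<lambda>h. (S h x - x) /\<^sub>R h) \<longlongrightarrow> y) (at_right 0) \<longleftrightarrow> x \<in> D \<and> y = B x))"

definition resolvent_op :: "'a::real_normed_vector set \<Rightarrow> ('a \<Rightarrow> 'a) \<Rightarrow> real \<Rightarrow> 'a \<Rightarrow> 'a" where
  "resolvent_op D B \<kappa> = inv_into D (\<lambda>x. \<kappa> *\<^sub>R x - B x)"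

definition resolvent_set :: "'a::real_normed_vector set \<Rightarrow> ('a \<Rightarrow> 'a) \<Rightarrow> real set" where
  "resolvent_set D B =
     {\<kappa>. bij_betw (\<lambda>x. \<kappa> *\<^sub>R x - B x) D UNIV \<and> bounded_linear (resolvent_op D B \<kappa>)}"

text \<open>For a sorted list \<open>[t\<^sub>1, \<dots>, t\<^sub>k]\<close> the \<^const>\<open>fold\<close> below is the time-ordered product
  \<open>R(t\<^sub>k) \<circ> \<dots> \<circ> R(t\<^sub>1)\<close> of the resolvents, with later times to the left.\<close>

definition stable_family :: "real \<Rightarrow> 'a::real_normed_vector set \<Rightarrow> (real \<Rightarrow> 'a \<Rightarrow> 'a) \<Rightarrow> bool" where
  "stable_family T D B \<longleftrightarrow>
     (\<exists>M\<ge>1. \<exists>\<omega>.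
       (\<forall>t\<in>{0..T}. {\<omega><..} \<subseteq> resolvent_set D (B t)) \<and>
       (\<forall>\<kappa>>\<omega>. \<forall>ts. sorted ts \<and> set ts \<subseteq> {0..T} \<longrightarrow>
          onorm (fold (\<lambda>t. resolvent_op D (B t) \<kappa>) ts) \<le> M / (\<kappa> - \<omega>) ^ length ts))"

definition standing_assumptions ::
  "real \<Rightarrow> 'a::{real_inner, banach} set \<Rightarrow> (real \<Rightarrow> 'a \<Rightarrow> 'a) \<Rightarrow> bool" where
  "standing_assumptions T D A \<longleftrightarrow>
     subspace D \<and> closure D = UNIV \<and>
     (\<forall>B \<in> {A, \<lambda>t x. - A (T - t) x}.
        (\<forall>t\<in>{0..T}. generates_C0_semigroup D (B t)) \<and> stable_family T D B) \<and>
     (\<forall>x\<in>D. \<exists>A'. continuous_on {0..T} A' \<and>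
        (\<forall>t\<in>{0..T}. ((\<lambda>t. A t x) has_vector_derivative A' t) (at t within {0..T})))"

subsection \<open>Evolution systems\<close>

definition evolution_system :: "real \<Rightarrow> (real \<Rightarrow> real \<Rightarrow> 'a::banach \<Rightarrow>\<^sub>L 'a) \<Rightarrow> bool" where
  "evolution_system T U \<longleftrightarrow>
     (\<forall>s\<in>{0..T}. U s s = id_blinfun) \<and>
     (\<forall>s \<sigma> t. 0 \<le> s \<and> s \<le> \<sigma> \<and> \<sigma> \<le> t \<and> t \<le> T \<longrightarrow> U t \<sigma> o\<^sub>L U \<sigma> s = U t s) \<and>
     (\<forall>x. continuous_on {(t, s). 0 \<le> s \<and> s \<le> t \<and> t \<le> T} (\<lambda>(t, s). U t s x))"

definition generates_evolution_system ::
  "real \<Rightarrow> 'a::banach set \<Rightarrow> (real \<Rightarrow> 'a \<Rightarrow> 'a) \<Rightarrow> (real \<Rightarrow> real \<Rightarrow> 'a \<Rightarrow>\<^sub>L 'a) \<Rightarrow> bool" where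
  "generates_evolution_system T D B U \<longleftrightarrow>
     evolution_system T U \<and>
     (\<forall>x\<in>D. \<forall>s t. 0 \<le> s \<and> s \<le> t \<and> t \<le> T \<longrightarrow>
        U t s x \<in> D \<and>
        ((\<lambda>\<tau>. U \<tau> s x) has_vector_derivative B t (U t s x)) (at t within {s..T}) \<and>
        ((\<lambda>\<sigma>. U t \<sigma> x) has_vector_derivative - U t s (B s x)) (at s within {0..t}))"

definition bidirectional_evolution_system ::
  "real \<Rightarrow> (real \<Rightarrow> real \<Rightarrow> 'a::banach \<Rightarrow>\<^sub>L 'a) \<Rightarrow> bool" where
  "bidirectional_evolution_system T U \<longleftrightarrow>
     (\<forall>t\<in>{0..T}. U t t = id_blinfun) \<and>
     (\<forall>t\<in>{0..T}. \<forall>s\<in>{0..T}. \<forall>\<sigma>\<in>{0..T}. U t s o\<^sub>L U s \<sigma> = U t \<sigma>) \<and>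
     (\<forall>t\<in>{0..T}. \<forall>x. ((\<lambda>s. U t s x) \<longlongrightarrow> x) (at t within {0..T}))"

definition generates_bidirectional ::
  "real \<Rightarrow> 'a::banach set \<Rightarrow> (real \<Rightarrow> 'a \<Rightarrow> 'a) \<Rightarrow> (real \<Rightarrow> real \<Rightarrow> 'a \<Rightarrow>\<^sub>L 'a) \<Rightarrow> bool" where
  "generates_bidirectional T D A U \<longleftrightarrow>
     bidirectional_evolution_system T U \<and>
     generates_evolution_system T D A U \<and>
     generates_evolution_system T D (\<lambda>t x. - A (T - t) x) (\<lambda>t s. U (T - t) (T - s)) \<and>
     (\<forall>t\<in>{0..T}. \<forall>s\<in>{0..T}. U s t o\<^sub>L U t s = id_blinfun)"

text \<open>Mild solution on \<open>[0, T]\<close> of \<open>w' = B(t) w + f(t)\<close> with datum prescribed at time \<open>a\<close>, where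
  \<open>U\<close> is the bi-directional evolution system generated by \<open>B\<close>:
  \<open>w(t) = U(t,a) w(a) + \<integral>\<^sub>a\<^sup>t U(t,s) f(s) ds\<close>. The case distinction is the oriented integral.\<close>

definition mild_solution ::
  "real \<Rightarrow> (real \<Rightarrow> real \<Rightarrow> 'a::banach \<Rightarrow>\<^sub>L 'a) \<Rightarrow> (real \<Rightarrow> 'a) \<Rightarrow> real \<Rightarrow> (real \<Rightarrow> 'a) \<Rightarrow> bool" where
  "mild_solution T U f a w \<longleftrightarrow>
     (\<forall>t\<in>{0..T}. w t = U t a (w a) +
        (if a \<le> t then integral {a..t} (\<lambda>s. U t s (f s))
         else - integral {t..a} (\<lambda>s. U t s (f s))))"

subsection \<open>Detectability and observability\<close>

definition weakly_detectable ::
  "real \<Rightarrow> 'a::real_inner set \<Rightarrow> (real \<Rightarrow> 'a \<Rightarrow> 'a) \<Rightarrow> ('a \<Rightarrow>\<^sub>L 'b::real_inner) \<Rightarrow> real \<Rightarrow> bool" where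
  "weakly_detectable T D A C \<mu> \<longleftrightarrow>
     (\<forall>t\<in>{0..T}. \<forall>x\<in>D. A t x \<bullet> x \<le> \<mu> * (norm (C x))\<^sup>2)"

definition observability_gramian ::
  "real \<Rightarrow> (real \<Rightarrow> real \<Rightarrow> 'a::{real_inner, banach} \<Rightarrow>\<^sub>L 'a) \<Rightarrow> ('a \<Rightarrow>\<^sub>L 'b::{real_inner, banach})
     \<Rightarrow> 'a \<Rightarrow> 'a" where
  "observability_gramian T U C x =
     integral {0..T} (\<lambda>t. adjoint (U t 0) (adjoint C (C (U t 0 x))))"

definition observable_subspace ::
  "real \<Rightarrow> (real \<Rightarrow> real \<Rightarrow> 'a::{real_inner, banach} \<Rightarrow>\<^sub>L 'a) \<Rightarrow> ('a \<Rightarrow>\<^sub>L 'b::{real_inner, banach})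
     \<Rightarrow> 'a set" where
  "observable_subspace T U C = {x. observability_gramian T U C x = 0}\<^sup>\<bottom>"

definition orthogonal_projection :: "'a::real_inner set \<Rightarrow> 'a \<Rightarrow> 'a" where
  "orthogonal_projection V x = (THE p. p \<in> V \<and> x - p \<in> V\<^sup>\<bottom>)"

definition weakly_converges :: "(nat \<Rightarrow> 'a::real_normed_vector) \<Rightarrow> 'a \<Rightarrow> bool" where
  "weakly_converges u l \<longleftrightarrow> (\<forall>\<phi> :: 'a \<Rightarrow>\<^sub>L real. (\<lambda>n. \<phi> (u n)) \<longlonglongrightarrow> \<phi> l)"

subsection \<open>Back and forth nudging\<close>

text \<open>\<open>z\<close> is a trajectory of the observed system, \<open>zh n\<close> the \<open>n\<close>-th pass of the algorithm.
  \<open>\<S>\<^sub>+\<close> and \<open>\<S>\<^sub>-\<close> are the systems generated by \<open>A - r C\<^sup>* C\<close> and \<open>A + r C\<^sup>* C\<close>, so the forward and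
  backward equations read \<open>w' = (A - r C\<^sup>* C) w + r C\<^sup>* y\<close> and \<open>w' = (A + r C\<^sup>* C) w - r C\<^sup>* y\<close>.
  The initial data \<open>z 0\<close> and \<open>zh 0 0\<close> are free.\<close>

definition back_and_forth_nudging ::
  "real \<Rightarrow> (real \<Rightarrow> real \<Rightarrow> 'a::{real_inner, banach} \<Rightarrow>\<^sub>L 'a) \<Rightarrow> (real \<Rightarrow> real \<Rightarrow> 'a \<Rightarrow>\<^sub>L 'a)
     \<Rightarrow> (real \<Rightarrow> real \<Rightarrow> 'a \<Rightarrow>\<^sub>L 'a) \<Rightarrow> ('a \<Rightarrow>\<^sub>L 'b::{real_inner, banach}) \<Rightarrow> real
     \<Rightarrow> (real \<Rightarrow> 'a) \<Rightarrow> (nat \<Rightarrow> real \<Rightarrow> 'a) \<Rightarrow> bool" where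
  "back_and_forth_nudging T U S\<^sub>p S\<^sub>m C r z zh \<longleftrightarrow>
     (let y = (\<lambda>t. C (z t)) in
        mild_solution T U (\<lambda>t. 0) 0 z \<and>
        (\<forall>n. mild_solution T S\<^sub>p (\<lambda>t. r *\<^sub>R adjoint C (y t)) 0 (zh (2 * n))) \<and>
        (\<forall>n. mild_solution T S\<^sub>m (\<lambda>t. - (r *\<^sub>R adjoint C (y t))) T (zh (2 * n + 1))) \<and>
        (\<forall>n\<ge>1. zh (2 * n) 0 = zh (2 * n - 1) 0) \<and>
        (\<forall>n. zh (2 * n + 1) T = zh (2 * n) T))"

definition weak_back_and_forth_observer ::
  "real \<Rightarrow> (real \<Rightarrow> real \<Rightarrow> 'a::{real_inner, banach} \<Rightarrow>\<^sub>L 'a) \<Rightarrow> (real \<Rightarrow> real \<Rightarrow> 'a \<Rightarrow>\<^sub>L 'a)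
     \<Rightarrow> (real \<Rightarrow> real \<Rightarrow> 'a \<Rightarrow>\<^sub>L 'a) \<Rightarrow> ('a \<Rightarrow>\<^sub>L 'b::{real_inner, banach}) \<Rightarrow> real \<Rightarrow> 'a set \<Rightarrow> bool" where
  "weak_back_and_forth_observer T U S\<^sub>p S\<^sub>m C r V \<longleftrightarrow>
     (\<forall>z zh. back_and_forth_nudging T U S\<^sub>p S\<^sub>m C r z zh \<longrightarrow>
        weakly_converges (\<lambda>n. orthogonal_projection V (zh (2 * n) 0 - z 0)) 0)"

end

theory Submission
  imports Defs
begin

text \<open>
  One round trip of the algorithm maps the error \<open>\<epsilon>\<close> at time \<open>0\<close> to \<open>S \<epsilon>\<close>, where
  \<open>S = \<S>\<^sub>-(0, T) \<S>\<^sub>+(T, 0)\<close>: by the variation of constants formula the observed trajectory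
  satisfies the same forced equations as the observer, so the forcing cancels in the error (lemma
  \<open>nudging_error_iteration\<close>). It remains to see why \<open>S\<^sup>n \<epsilon>\<close> tends to \<open>0\<close> weakly on the observable
  subspace.

  By weak detectability with \<open>\<mu> < r\<close>, both factors of \<open>S\<close> are contractions, and the forward pass
  even satisfies
  \<open>\<parallel>\<S>\<^sub>+(T, 0) x\<parallel>\<^sup>2 + 2 (r - \<mu>) \<integral> \<parallel>C \<S>\<^sub>+(t, 0) x\<parallel>\<^sup>2 dt \<le> \<parallel>x\<parallel>\<^sup>2\<close> (lemma \<open>damped_output_energy\<close>).
  The squared norms of the iterates therefore converge, and the output energies of successive
  passes tend to \<open>0\<close>. A second energy estimate, for the difference between the damped and the
  undamped trajectory, bounds the undamped output energy by a multiple of the damped one (lemma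
  \<open>undamped_output_le_damped_output\<close>), so \<open>\<langle>W S\<^sup>n \<epsilon>, S\<^sup>n \<epsilon>\<rangle> \<rightarrow> 0\<close> for the observability Gramian \<open>W\<close>.
  As the quadratic form of \<open>W\<close> is nonnegative, \<open>\<langle>S\<^sup>n \<epsilon>, W y\<rangle> \<rightarrow> 0\<close> for all \<open>y\<close>; the range of \<open>W\<close> is
  dense in \<open>(ker W)\<^sup>\<bottom>\<close> and the iterates are bounded, so \<open>\<langle>S\<^sup>n \<epsilon>, v\<rangle> \<rightarrow> 0\<close> for every observable \<open>v\<close>
  (lemma \<open>weak_limit_on_observable_part\<close>).

  Everything that is differentiated starts in the common domain of the generators. Since all
  quantities in the estimates depend continuously on the initial value, the estimates extend by
  density.
\<close>

section \<open>Projections, Riesz representation and adjoints in real Hilbert spaces\<close>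

lemma ex_nearest_point_closed_subspace:
  fixes V :: "'a::{real_inner, banach} set"
  assumes V: "subspace V" "closed V"
  shows "\<exists>p\<in>V. \<forall>v\<in>V. norm (x - p) \<le> norm (x - v)"
proof -
  define d where "d = infdist x V"
  have ne: "V \<noteq> {}" using subspace_0[OF V(1)] by blast
  have d_le: "d \<le> norm (x - v)" if "v \<in> V" for v
    using infdist_le[OF that, of x] by (simp add: d_def dist_norm)
  have d0: "0 \<le> d" by (simp add: d_def infdist_nonneg)
  have "\<exists>v\<in>V. (norm (x - v))\<^sup>2 < d\<^sup>2 + 1 / real (Suc n)" for n
  proof (rule ccontr)
    assume "\<not> ?thesis"
    hence "sqrt (d\<^sup>2 + 1 / real (Suc n)) \<le> dist x v" if "v \<in> V" for v
      using that by (auto simp: dist_norm not_less intro!: real_le_lsqrt)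
    hence "sqrt (d\<^sup>2 + 1 / real (Suc n)) \<le> d"
      unfolding d_def infdist_notempty[OF ne] by (intro cINF_greatest[OF ne]) auto
    hence "d\<^sup>2 + 1 / real (Suc n) \<le> d\<^sup>2"
      using d0 by (metis real_sqrt_le_iff real_sqrt_unique)
    thus False by simp
  qed
  then obtain v where vV: "\<And>n. v n \<in> V"
    and v_near: "\<And>n. (norm (x - v n))\<^sup>2 < d\<^sup>2 + 1 / real (Suc n)" by metis
  \<comment> \<open>The midpoint of two members stays in \<open>V\<close>, hence at distance at least \<open>d\<close>; the
    parallelogram identity turns this into closeness of the two members.\<close>
  have close: "(norm (v m - v n))\<^sup>2 \<le> 2 / real (Suc m) + 2 / real (Suc n)" for m n
  proof -
    have "d \<le> norm (x - (1/2) *\<^sub>R (v m + v n))"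
      using V(1) vV by (intro d_le subspace_scale subspace_add)
    hence "d\<^sup>2 \<le> (norm (x - (1/2) *\<^sub>R (v m + v n)))\<^sup>2"
      using d0 by (rule power_mono)
    moreover have "(norm (v m - v n))\<^sup>2
        = 2 * (norm (x - v m))\<^sup>2 + 2 * (norm (x - v n))\<^sup>2
          - 4 * (norm (x - (1/2) *\<^sub>R (v m + v n)))\<^sup>2"
      by (simp add: power2_norm_eq_inner inner_commute algebra_simps)
    ultimately show ?thesis using v_near[of m] v_near[of n] by simp
  qed
  have "Cauchy v"
  proof (rule metric_CauchyI)
    fix e :: real assume e: "0 < e"
    obtain N where N: "4 / e\<^sup>2 < real N" using reals_Archimedean2 by blast
    have "dist (v m) (v n) < e" if "m \<ge> N" "n \<ge> N" for m n
    proof -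
      have N0: "0 < real N" using N e by (meson divide_pos_pos less_trans zero_less_numeral zero_less_power)
      have "2 / real (Suc m) \<le> 2 / real N" "2 / real (Suc n) \<le> 2 / real N"
        using that N0 by (auto intro!: divide_left_mono)
      hence "(norm (v m - v n))\<^sup>2 \<le> 4 / real N" using close[of m n] by linarith
      also have "\<dots> < e\<^sup>2" using N N0 e by (simp add: field_simps)
      finally show ?thesis using e by (simp add: dist_norm power_less_imp_less_base)
    qed
    thus "\<exists>N. \<forall>m\<ge>N. \<forall>n\<ge>N. dist (v m) (v n) < e" by blast
  qed
  then obtain p where p: "v \<longlonglongrightarrow> p" using Cauchy_convergent_iff convergent_def by blast
  have pV: "p \<in> V" using closed_sequentially[OF V(2) _ p] vV by blast
  have "(\<lambda>n. (norm (x - v n))\<^sup>2) \<longlonglongrightarrow> (norm (x - p))\<^sup>2" by (intro tendsto_intros p)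
  moreover have "(\<lambda>n. d\<^sup>2 + 1 / real (Suc n)) \<longlonglongrightarrow> d\<^sup>2 + 0"
    by (intro tendsto_intros LIMSEQ_Suc[OF lim_1_over_n])
  ultimately have "(norm (x - p))\<^sup>2 \<le> d\<^sup>2"
    using v_near by (auto intro: LIMSEQ_le less_imp_le)
  hence "norm (x - p) \<le> d" using d0 by (rule power2_le_imp_le)
  thus ?thesis using pV d_le by (meson order_trans)
qed

lemma ex_orthogonal_decomposition:
  fixes V :: "'a::{real_inner, banach} set"
  assumes V: "subspace V" "closed V"
  shows "\<exists>p\<in>V. x - p \<in> V\<^sup>\<bottom>"
proof -
  obtain p where p: "p \<in> V" "\<And>v. v \<in> V \<Longrightarrow> norm (x - p) \<le> norm (x - v)"
    using ex_nearest_point_closed_subspace[OF V] by blast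
  have "v \<bullet> (x - p) = 0" if v: "v \<in> V" for v
  proof (rule ccontr)
    assume nz: "v \<bullet> (x - p) \<noteq> 0"
    define t where "t = (v \<bullet> (x - p)) / (v \<bullet> v)"
    have v0: "0 < v \<bullet> v" using nz by auto
    \<comment> \<open>With this \<open>t\<close>, the point \<open>p + t v\<close> minimises the distance to \<open>x\<close> along the line through \<open>p\<close>.\<close>
    have "p + t *\<^sub>R v \<in> V" using p(1) v V(1) by (intro subspace_add subspace_scale)
    hence "(norm (x - p))\<^sup>2 \<le> (norm (x - (p + t *\<^sub>R v)))\<^sup>2"
      using p(2) by (intro power_mono) auto
    also have "\<dots> = (norm (x - p))\<^sup>2 - 2 * t * (v \<bullet> (x - p)) + t * t * (v \<bullet> v)"
      by (simp add: power2_norm_eq_inner inner_commute algebra_simps)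
    also have "\<dots> = (norm (x - p))\<^sup>2 - (v \<bullet> (x - p))\<^sup>2 / (v \<bullet> v)"
      using v0 by (simp add: t_def field_simps power2_eq_square)
    finally have "(v \<bullet> (x - p))\<^sup>2 / (v \<bullet> v) \<le> 0" by simp
    thus False using nz v0 by (simp add: divide_le_0_iff)
  qed
  thus ?thesis using p(1) unfolding orthogonal_comp_def orthogonal_def by blast
qed

text \<open>
  Two members of \<open>V\<close> that both qualify differ by an element of \<open>V \<inter> V\<^sup>\<bottom> = {0}\<close>, so the description
  that defines the projection denotes.
\<close>

lemma orthogonal_projection_works:
  fixes V :: "'a::{real_inner, banach} set"
  assumes V: "subspace V" "closed V"
  shows "orthogonal_projection V x \<in> V \<and> x - orthogonal_projection V x \<in> V\<^sup>\<bottom>"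
  unfolding orthogonal_projection_def
proof (rule theI')
  obtain p where p: "p \<in> V" "x - p \<in> V\<^sup>\<bottom>" using ex_orthogonal_decomposition[OF V] by blast
  have "q = p" if q: "q \<in> V" "x - q \<in> V\<^sup>\<bottom>" for q
  proof -
    have "(x - p) - (x - q) \<in> V\<^sup>\<bottom>"
      using p(2) q(2) by (rule subspace_diff[OF subspace_orthogonal_comp])
    moreover have "q - p \<in> V" using q(1) p(1) by (rule subspace_diff[OF V(1)])
    ultimately have "(q - p) \<bullet> (q - p) = 0" 
      unfolding orthogonal_comp_def orthogonal_def by auto
    thus ?thesis by simp
  qed
  thus "\<exists>!p. p \<in> V \<and> x - p \<in> V\<^sup>\<bottom>" using p by blast
qed

lemma orthogonal_projection_self_adjoint:
  fixes V :: "'a::{real_inner, banach} set"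
  assumes V: "subspace V" "closed V"
  shows "orthogonal_projection V x \<bullet> y = x \<bullet> orthogonal_projection V y"
proof -
  let ?P = "orthogonal_projection V"
  have "(x - ?P x) \<bullet> ?P y = 0" "?P x \<bullet> (y - ?P y) = 0"
    using orthogonal_projection_works[OF V]
    unfolding orthogonal_comp_def orthogonal_def by (auto simp: inner_commute)
  thus ?thesis by (simp add: inner_diff_left inner_diff_right)
qed

lemma closed_orthogonal_comp: "closed (W\<^sup>\<bottom>)"
  for W :: "'a::real_inner set"
proof -
  have "W\<^sup>\<bottom> = (\<Inter>y\<in>W. {x. y \<bullet> x = 0})"
    unfolding orthogonal_comp_def orthogonal_def by auto
  thus ?thesis by (auto intro!: closed_INT closed_Collect_eq continuous_intros)
qed

text \<open>
  The kernel of \<open>f\<close> is a closed subspace; if it is not everything, its orthogonal complement is a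
  line, and a suitable multiple of any nonzero vector \<open>u\<close> on that line represents \<open>f\<close>.
\<close>

lemma riesz_representation:
  fixes f :: "'a::{real_inner, banach} \<Rightarrow> real"
  assumes f: "bounded_linear f"
  shows "\<exists>v. \<forall>x. f x = x \<bullet> v"
proof (cases "\<forall>x. f x = 0")
  case True
  thus ?thesis by (intro exI[of _ 0]) simp
next
  case False
  then obtain x0 where x0: "f x0 \<noteq> 0" by blast
  interpret bounded_linear f by (rule f)
  let ?N = "{x. f x = 0}"
  have "subspace ?N" by (auto simp: subspace_def add scaleR zero)
  moreover have "closed ?N" by (intro closed_Collect_eq continuous_on continuous_intros) 
  ultimately obtain p where p: "f p = 0" "x0 - p \<in> ?N\<^sup>\<bottom>"
    using ex_orthogonal_decomposition[of ?N x0] by blast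
  define u where "u = x0 - p"
  have fu: "f u = f x0" by (simp add: u_def diff p(1))
  have u0: "u \<bullet> u \<noteq> 0" using fu x0 zero by auto
  have "f x = x \<bullet> ((f u / (u \<bullet> u)) *\<^sub>R u)" for x
  proof -
    have "f (x - (f x / f u) *\<^sub>R u) = 0" using x0 fu by (simp add: diff scaleR)
    hence "(x - (f x / f u) *\<^sub>R u) \<bullet> u = 0"
      using p(2) unfolding u_def orthogonal_comp_def orthogonal_def by blast
    hence "x \<bullet> u = f x / f u * (u \<bullet> u)" by (simp add: inner_diff_left)
    thus ?thesis using u0 x0 fu by simp
  qed
  thus ?thesis by blast
qed

text \<open>
  \<^const>\<open>adjoint\<close> is a choice, so every use of it needs some adjoint to exist. On a complete space
  the Riesz theorem provides one.
\<close>

lemma adjoint_blinfun_works: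
  fixes C :: "'a::{real_inner, banach} \<Rightarrow>\<^sub>L 'b::real_inner"
  shows "C x \<bullet> y = x \<bullet> adjoint C y"
proof -
  have "\<exists>v. \<forall>x. C x \<bullet> y = x \<bullet> v" for y
    by (intro riesz_representation bounded_linear_intros blinfun.bounded_linear_right)
  then obtain g where "\<forall>x y. C x \<bullet> y = x \<bullet> g y" by metis
  thus ?thesis using adjoint_unique[of C g] by simp
qed

lemma adjoint_blinfun_zero:
  fixes C :: "'a::{real_inner, banach} \<Rightarrow>\<^sub>L 'b::real_inner"
  shows "adjoint C 0 = 0"
  using adjoint_blinfun_works[of C "adjoint C 0" 0] by simp

lemma bounded_linear_adjoint_blinfun:
  fixes C :: "'a::{real_inner, banach} \<Rightarrow>\<^sub>L 'b::real_inner"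
  shows "bounded_linear (adjoint C)"
proof (rule bounded_linear_intro[where K = "norm C"])
  show "adjoint C (x + y) = adjoint C x + adjoint C y" for x y
    by (rule vector_eq_ldot[THEN iffD1])
      (simp add: inner_add_right flip: adjoint_blinfun_works)
  show "adjoint C (c *\<^sub>R x) = c *\<^sub>R adjoint C x" for c x
    by (rule vector_eq_ldot[THEN iffD1])
      (simp flip: adjoint_blinfun_works)
  show "norm (adjoint C x) \<le> norm x * norm C" for x
  proof (cases "adjoint C x = 0")
    case False
    have "norm (adjoint C x) * norm (adjoint C x) = C (adjoint C x) \<bullet> x"
      by (simp add: adjoint_blinfun_works power2_norm_eq_inner flip: power2_eq_square)
    also have "\<dots> \<le> norm (C (adjoint C x)) * norm x" by (rule norm_cauchy_schwarz)
    also have "\<dots> \<le> (norm C * norm (adjoint C x)) * norm x"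
      by (intro mult_right_mono norm_blinfun) auto
    finally show ?thesis using False by (simp add: mult.commute mult.left_commute)
  qed simp
qed

section \<open>Differential inequalities and strongly continuous families\<close>

lemma integral_reverse_interval:
  fixes f :: "real \<Rightarrow> 'b::banach"
  shows "integral {0..T} (\<lambda>s. f (T - s)) = integral {0..T} f"
proof -
  have "integral {0..T} (\<lambda>s. f (T - s)) = integral {-T..-0} (\<lambda>s. f (- s))"
    using integral_shift_real_ivl[of "-T" "-T" 0 "\<lambda>s. f (- s)"] by (simp add: algebra_simps)
  thus ?thesis using Henstock_Kurzweil_Integration.integral_reflect_real[of T 0 f] by simp
qed

lemma increment_le_integral:
  fixes \<phi> :: "real \<Rightarrow> real"
  assumes "a \<le> b"
    and "\<And>t. t \<in> {a..b} \<Longrightarrow> (\<phi> has_real_derivative \<phi>' t) (at t within {a..b})"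
    and "\<And>t. t \<in> {a..b} \<Longrightarrow> \<phi>' t \<le> \<psi> t"
    and "continuous_on {a..b} \<psi>"
  shows "\<phi> b - \<phi> a \<le> integral {a..b} \<psi>"
proof (rule has_integral_le)
  show "(\<phi>' has_integral \<phi> b - \<phi> a) {a..b}"
    using assms(2) by (intro fundamental_theorem_of_calculus[OF assms(1)])
      (simp add: has_real_derivative_iff_has_vector_derivative)
  show "(\<psi> has_integral integral {a..b} \<psi>) {a..b}"
    using assms(4) by (intro integrable_integral integrable_continuous_interval)
qed (use assms(3) in auto)

text \<open>
  Multiplying \<open>\<phi>\<close> by \<open>exp (- K (t - a))\<close> removes the term \<open>K \<phi>\<close> from the differential inequality;
  since \<open>\<psi> \<ge> 0\<close>, the weight in front of \<open>\<psi>\<close> may be replaced by its maximum \<open>1\<close>.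
\<close>

lemma gronwall_bound:
  fixes \<phi> :: "real \<Rightarrow> real"
  assumes ab: "a \<le> b" and K: "0 \<le> K"
    and deriv: "\<And>t. t \<in> {a..b} \<Longrightarrow> (\<phi> has_real_derivative \<phi>' t) (at t within {a..b})"
    and le: "\<And>t. t \<in> {a..b} \<Longrightarrow> \<phi>' t \<le> K * \<phi> t + \<psi> t"
    and \<psi>: "continuous_on {a..b} \<psi>" "\<And>t. t \<in> {a..b} \<Longrightarrow> 0 \<le> \<psi> t"
  shows "\<phi> b \<le> exp (K * (b - a)) * (\<phi> a + integral {a..b} \<psi>)"
proof -
  let ?E = "\<lambda>t. exp (- K * (t - a))"
  have "?E b * \<phi> b - ?E a * \<phi> a \<le> integral {a..b} \<psi>"
  proof (rule increment_le_integral[OF ab _ _ \<psi>(1)])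
    fix t assume t: "t \<in> {a..b}"
    show "((\<lambda>t. ?E t * \<phi> t) has_real_derivative ?E t * (\<phi>' t - K * \<phi> t)) (at t within {a..b})"
      by (auto intro!: derivative_eq_intros deriv[OF t] simp: algebra_simps)
    have "?E t * (\<phi>' t - K * \<phi> t) \<le> ?E t * \<psi> t"
      using le[OF t] by (intro mult_left_mono) auto
    also have "\<dots> \<le> 1 * \<psi> t"
      using t K \<psi>(2)[OF t] by (intro mult_right_mono) (auto simp: mult_nonneg_nonneg)
    finally show "?E t * (\<phi>' t - K * \<phi> t) \<le> \<psi> t" by simp
  qed
  hence "?E b * \<phi> b \<le> \<phi> a + integral {a..b} \<psi>" by simp
  hence "exp (K * (b - a)) * (?E b * \<phi> b) \<le> exp (K * (b - a)) * (\<phi> a + integral {a..b} \<psi>)"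
    by (rule mult_left_mono) simp
  thus ?thesis by (simp add: mult.assoc[symmetric] flip: exp_add)
qed

lemma has_real_derivative_norm_square:
  fixes w :: "real \<Rightarrow> 'a::real_inner"
  assumes "(w has_vector_derivative w') (at t within S)"
  shows "((\<lambda>t. (norm (w t))\<^sup>2) has_real_derivative 2 * (w' \<bullet> w t)) (at t within S)"
proof -
  have "((\<lambda>t. w t \<bullet> w t) has_derivative (\<lambda>h. w t \<bullet> (h *\<^sub>R w') + (h *\<^sub>R w') \<bullet> w t)) (at t within S)"
    using assms unfolding has_vector_derivative_def by (intro has_derivative_inner)
  thus ?thesis
    unfolding has_field_derivative_def power2_norm_eq_inner
    by (rule has_derivative_eq_rhs) (auto simp: inner_commute algebra_simps)
qed

lemma has_vector_derivative_iff_quotient_tendsto: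
  fixes f :: "real \<Rightarrow> 'a::real_normed_vector"
  shows "(f has_vector_derivative f') (at x within S) \<longleftrightarrow>
    ((\<lambda>y. (f y - f x) /\<^sub>R (y - x)) \<longlongrightarrow> f') (at x within S)"
proof -
  have "norm (f y - f x - (y - x) *\<^sub>R f') / norm (y - x) = norm ((f y - f x) /\<^sub>R (y - x) - f')"
    if "y \<noteq> x" for y
  proof -
    have "(f y - f x) /\<^sub>R (y - x) - f' = (f y - f x - (y - x) *\<^sub>R f') /\<^sub>R (y - x)"
      using that by (simp add: scaleR_diff_right)
    thus ?thesis by (simp add: divide_inverse mult.commute)
  qed
  hence "((\<lambda>y. norm (f y - f x - (y - x) *\<^sub>R f') / norm (y - x)) \<longlongrightarrow> 0) (at x within S)
     \<longleftrightarrow> ((\<lambda>y. norm ((f y - f x) /\<^sub>R (y - x) - f')) \<longlongrightarrow> 0) (at x within S)"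
    by (intro tendsto_cong) (auto simp: eventually_at_filter)
  also have "\<dots> \<longleftrightarrow> ((\<lambda>y. (f y - f x) /\<^sub>R (y - x)) \<longlongrightarrow> f') (at x within S)"
    by (simp only: tendsto_norm_zero_iff LIM_zero_iff)
  finally show ?thesis
    unfolding has_vector_derivative_def has_derivative_iff_norm
    by (simp add: bounded_linear_scaleR_left)
qed

lemma tendsto_bounded_family_null:
  fixes G :: "'c \<Rightarrow> 'a::real_normed_vector \<Rightarrow>\<^sub>L 'b::real_normed_vector"
  assumes "eventually (\<lambda>s. \<forall>x. norm (G s x) \<le> M * norm x) F" and q: "(q \<longlongrightarrow> 0) F"
  shows "((\<lambda>s. G s (q s)) \<longlongrightarrow> 0) F"
proof (rule tendsto_0_le[where K = M, OF q])
  show "\<forall>\<^sub>F s in F. norm (G s (q s)) \<le> norm (q s) * M"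
    using assms(1) by eventually_elim (simp add: mult.commute)
qed

text \<open>
  Joint continuity in time and in the vector is what lets the energy inequalities, which are derived
  by differentiating along trajectories in the domain of the generators, pass to its closure.
\<close>

lemma continuous_on_bounded_family:
  fixes G :: "'c::topological_space \<Rightarrow> 'a::real_normed_vector \<Rightarrow>\<^sub>L 'b::real_normed_vector"
  assumes bd: "\<And>s x. s \<in> S \<Longrightarrow> norm (G s x) \<le> M * norm x"
    and cont: "\<And>x. continuous_on S (\<lambda>s. G s x)"
  shows "continuous_on (UNIV \<times> S) (\<lambda>(x, s). G s x)"
  unfolding continuous_on_def case_prod_unfold
proof (rule ballI)
  fix p :: "'a \<times> 'c" assume p: "p \<in> UNIV \<times> S"
  let ?F = "at p within (UNIV \<times> S)"
  have S: "eventually (\<lambda>q. q \<in> UNIV \<times> S) ?F" by (simp add: eventually_at_filter)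
  have fst: "(fst \<longlongrightarrow> fst p) ?F" and snd: "(snd \<longlongrightarrow> snd p) ?F"
    by (auto intro!: tendsto_eq_intros)
  have "((\<lambda>q. G (snd q) (fst p)) \<longlongrightarrow> G (snd p) (fst p)) ?F"
    by (rule continuous_on_tendsto_compose[OF cont snd])
      (use p S in \<open>auto elim!: eventually_mono\<close>)
  moreover have "((\<lambda>q. G (snd q) (fst q - fst p)) \<longlongrightarrow> 0) ?F"
    using S bd LIM_zero[OF fst]
    by (intro tendsto_bounded_family_null[where M = M]) (auto elim!: eventually_mono)
  ultimately have "((\<lambda>q. G (snd q) (fst p) + G (snd q) (fst q - fst p))
      \<longlongrightarrow> G (snd p) (fst p) + 0) ?F"
    by (rule tendsto_add)
  thus "((\<lambda>q. G (snd q) (fst q)) \<longlongrightarrow> G (snd p) (fst p)) ?F"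
    by (simp add: blinfun.diff_right)
qed

lemma continuous_on_bounded_family_compose:
  fixes G :: "'c::topological_space \<Rightarrow> 'a::real_normed_vector \<Rightarrow>\<^sub>L 'b::real_normed_vector"
  assumes "\<And>s x. s \<in> S \<Longrightarrow> norm (G s x) \<le> M * norm x"
    and "\<And>x. continuous_on S (\<lambda>s. G s x)"
    and "continuous_on R f" "continuous_on R g" "g ` R \<subseteq> S"
  shows "continuous_on R (\<lambda>p. G (g p) (f p))"
proof -
  have "continuous_on R (\<lambda>p. (f p, g p))" by (intro continuous_on_Pair assms)
  from continuous_on_compose2[OF continuous_on_bounded_family[OF assms(1,2)] this]
  show ?thesis using assms(5) by auto
qed

text \<open>
  A product rule for families that are merely strongly continuous. In
  \<open>G(\<sigma>) w(\<sigma>) = G(\<sigma>) w(s) + G(\<sigma>) (w(\<sigma>) - w(s))\<close> the first summand is differentiated at the fixed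
  vector \<open>w(s)\<close>; in the second, uniform boundedness allows the difference quotient of \<open>w\<close> to be
  replaced by its limit \<open>w'\<close>.
\<close>

lemma has_vector_derivative_bounded_family_apply:
  fixes G :: "real \<Rightarrow> 'a::real_normed_vector \<Rightarrow>\<^sub>L 'b::real_normed_vector"
  assumes bd: "\<And>\<sigma> x. \<sigma> \<in> S \<Longrightarrow> norm (G \<sigma> x) \<le> M * norm x"
    and cont: "\<And>x. continuous_on S (\<lambda>\<sigma>. G \<sigma> x)"
    and s: "s \<in> S"
    and G: "((\<lambda>\<sigma>. G \<sigma> (w s)) has_vector_derivative g) (at s within S)"
    and w: "(w has_vector_derivative w') (at s within S)"
  shows "((\<lambda>\<sigma>. G \<sigma> (w \<sigma>)) has_vector_derivative g + G s w') (at s within S)"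
  unfolding has_vector_derivative_iff_quotient_tendsto
proof -
  let ?F = "at s within S"
  let ?q = "\<lambda>\<sigma>. (w \<sigma> - w s) /\<^sub>R (\<sigma> - s)"
  have S: "eventually (\<lambda>\<sigma>. \<sigma> \<in> S) ?F" by (simp add: eventually_at_filter)
  have "((\<lambda>\<sigma>. ?q \<sigma> - w') \<longlongrightarrow> 0) ?F"
    using w unfolding has_vector_derivative_iff_quotient_tendsto by (rule LIM_zero)
  hence "((\<lambda>\<sigma>. G \<sigma> (?q \<sigma> - w')) \<longlongrightarrow> 0) ?F"
    using S bd by (intro tendsto_bounded_family_null[where M = M]) (auto elim!: eventually_mono)
  moreover have "((\<lambda>\<sigma>. G \<sigma> w') \<longlongrightarrow> G s w') ?F"
    using cont[of w'] s by (auto simp: continuous_on_def)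
  moreover have "((\<lambda>\<sigma>. (G \<sigma> (w s) - G s (w s)) /\<^sub>R (\<sigma> - s)) \<longlongrightarrow> g) ?F"
    using G unfolding has_vector_derivative_iff_quotient_tendsto .
  ultimately have "((\<lambda>\<sigma>. (G \<sigma> (w s) - G s (w s)) /\<^sub>R (\<sigma> - s) + (G \<sigma> (?q \<sigma> - w') + G \<sigma> w'))
      \<longlongrightarrow> g + (0 + G s w')) ?F"
    by (intro tendsto_add)
  moreover have "(G \<sigma> (w s) - G s (w s)) /\<^sub>R (\<sigma> - s) + (G \<sigma> (?q \<sigma> - w') + G \<sigma> w')
      = (G \<sigma> (w \<sigma>) - G s (w s)) /\<^sub>R (\<sigma> - s)" for \<sigma>
    by (simp add: blinfun.diff_right blinfun.scaleR_right scaleR_diff_right)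
  ultimately show "((\<lambda>\<sigma>. (G \<sigma> (w \<sigma>) - G s (w s)) /\<^sub>R (\<sigma> - s)) \<longlongrightarrow> g + G s w') ?F"
    by simp
qed

lemma le_on_dense:
  fixes f g :: "'a::topological_space \<Rightarrow> real"
  assumes "closure D = UNIV" "continuous_on UNIV f" "continuous_on UNIV g"
    and "\<And>x. x \<in> D \<Longrightarrow> f x \<le> g x"
  shows "f x \<le> g x"
  using closure_minimal[OF _ closed_Collect_le[OF assms(2,3)], of D] assms(1,4) by auto

lemma eq_on_dense:
  fixes f g :: "'a::topological_space \<Rightarrow> 'b::t2_space"
  assumes "closure D = UNIV" "continuous_on UNIV f" "continuous_on UNIV g"
    and "\<And>x. x \<in> D \<Longrightarrow> f x = g x"
  shows "f x = g x"
  using closure_minimal[OF _ closed_Collect_eq[OF assms(2,3)], of D] assms(1,4) by auto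

section \<open>Evolution systems with a one-sided bound on the generator\<close>

lemma evolution_system_continuous:
  assumes "evolution_system T E"
  shows "continuous_on {0..T} (\<lambda>t. E t 0 x)" and "continuous_on {0..T} (\<lambda>s. E T s x)"
proof -
  have c: "continuous_on {(t, s). 0 \<le> s \<and> s \<le> t \<and> t \<le> T} (\<lambda>(t, s). E t s x)"
    using assms by (simp add: evolution_system_def)
  have "continuous_on {0..T} (\<lambda>t. (t, 0::real))" by (intro continuous_intros)
  from continuous_on_compose2[OF c this] show "continuous_on {0..T} (\<lambda>t. E t 0 x)"
    by (auto simp: image_subset_iff)
  have "continuous_on {0..T} (\<lambda>s. (T, s))" by (intro continuous_intros)
  from continuous_on_compose2[OF c this] show "continuous_on {0..T} (\<lambda>s. E T s x)"
    by (auto simp: image_subset_iff)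
qed

text \<open>
  For a trajectory \<open>w\<close> starting in \<open>D\<close> the derivative of \<open>\<parallel>w\<parallel>\<^sup>2\<close> is \<open>2 \<langle>B w, w\<rangle> \<le> 2 K \<parallel>w\<parallel>\<^sup>2\<close>, so the
  bound is Gronwall's inequality, extended to all initial data by density. For \<open>K = 0\<close> the
  evolution system consists of contractions.
\<close>

lemma evolution_system_growth_bound:
  fixes E :: "real \<Rightarrow> real \<Rightarrow> 'a::{real_inner, banach} \<Rightarrow>\<^sub>L 'a"
  assumes gen: "generates_evolution_system T D B E" and dense: "closure D = UNIV"
    and K: "0 \<le> K" and diss: "\<And>t x. t \<in> {0..T} \<Longrightarrow> x \<in> D \<Longrightarrow> B t x \<bullet> x \<le> K * (norm x)\<^sup>2"
    and st: "0 \<le> s" "s \<le> t" "t \<le> T"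
  shows "norm (E t s x) \<le> exp (K * (t - s)) * norm x"
proof (rule le_on_dense[OF dense, where f = "\<lambda>x. norm (E t s x)" and x = x])
  fix x assume x: "x \<in> D"
  have ss: "E s s x = x" using gen st
    by (simp add: generates_evolution_system_def evolution_system_def)
  have "(norm (E t s x))\<^sup>2 \<le> exp (2 * K * (t - s)) * ((norm (E s s x))\<^sup>2 + integral {s..t} (\<lambda>_. 0))"
  proof (rule gronwall_bound[OF st(2)])
    fix \<tau> assume \<tau>: "\<tau> \<in> {s..t}"
    have D: "E \<tau> s x \<in> D"
      and "((\<lambda>\<tau>. E \<tau> s x) has_vector_derivative B \<tau> (E \<tau> s x)) (at \<tau> within {s..T})"
      using gen x \<tau> st by (auto simp: generates_evolution_system_def)
    thus "((\<lambda>\<tau>. (norm (E \<tau> s x))\<^sup>2) has_real_derivative 2 * (B \<tau> (E \<tau> s x) \<bullet> E \<tau> s x))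
        (at \<tau> within {s..t})"
      using st by (intro has_real_derivative_norm_square)
        (rule has_vector_derivative_within_subset, auto)
    show "2 * (B \<tau> (E \<tau> s x) \<bullet> E \<tau> s x) \<le> 2 * K * (norm (E \<tau> s x))\<^sup>2 + 0"
      using diss[OF _ D, of \<tau>] \<tau> st by auto
  qed (use K in auto)
  also have "\<dots> = (exp (K * (t - s)) * norm x)\<^sup>2"
    by (simp add: ss power_mult_distrib mult.assoc flip: exp_double)
  finally show "norm (E t s x) \<le> exp (K * (t - s)) * norm x"
    by (rule power2_le_imp_le) simp
qed (intro continuous_intros)+

lemma continuous_on_integral_parameter:
  fixes F :: "'a::topological_space \<Rightarrow> real \<Rightarrow> 'b::banach"
  assumes "continuous_on (UNIV \<times> {0..T}) (\<lambda>(x, t). F x t)"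
  shows "continuous_on UNIV (\<lambda>x. integral {0..T} (F x))"
  using integral_continuous_on_param[of UNIV 0 T F] assms by simp

text \<open>
  For \<open>x \<in> D\<close> the function \<open>s \<mapsto> E\<^sub>2(T, s) E\<^sub>1(s, 0) x\<close> interpolates between \<open>E\<^sub>2(T, 0) x\<close> and
  \<open>E\<^sub>1(T, 0) x\<close>. In its derivative the two generators cancel except for their bounded difference
  \<open>P\<close>. Both sides of the formula depend continuously on \<open>x\<close>.
\<close>

lemma duhamel_formula:
  fixes E\<^sub>1 E\<^sub>2 :: "real \<Rightarrow> real \<Rightarrow> 'a::{real_inner, banach} \<Rightarrow>\<^sub>L 'a"
  assumes T: "0 \<le> T" and dense: "closure D = UNIV"
    and gen1: "generates_evolution_system T D B\<^sub>1 E\<^sub>1"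
    and gen2: "generates_evolution_system T D (\<lambda>t x. B\<^sub>1 t x - P x) E\<^sub>2"
    and P: "bounded_linear P"
    and bd1: "\<And>t x. t \<in> {0..T} \<Longrightarrow> norm (E\<^sub>1 t 0 x) \<le> M\<^sub>1 * norm x"
    and bd2: "\<And>s x. s \<in> {0..T} \<Longrightarrow> norm (E\<^sub>2 T s x) \<le> M\<^sub>2 * norm x"
  shows "E\<^sub>1 T 0 x = E\<^sub>2 T 0 x + integral {0..T} (\<lambda>s. E\<^sub>2 T s (P (E\<^sub>1 s 0 x)))"
proof (rule eq_on_dense[OF dense, where f = "\<lambda>x. E\<^sub>1 T 0 x" and x = x])
  have ev: "evolution_system T E\<^sub>1" "evolution_system T E\<^sub>2"
    using gen1 gen2 by (auto simp: generates_evolution_system_def)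
  note c1 = evolution_system_continuous(1)[OF ev(1)] and c2 = evolution_system_continuous(2)[OF ev(2)]
  have "continuous_on (UNIV \<times> {0..T}) (\<lambda>p. E\<^sub>2 T (snd p) (P (E\<^sub>1 (snd p) 0 (fst p))))"
    by (intro continuous_on_bounded_family_compose[OF bd2 c2]
        continuous_on_bounded_family_compose[where G = "\<lambda>t. E\<^sub>1 t 0", OF bd1 c1]
        bounded_linear.continuous_on[OF P] continuous_intros) auto
  thus "continuous_on UNIV (\<lambda>x. E\<^sub>2 T 0 x + integral {0..T} (\<lambda>s. E\<^sub>2 T s (P (E\<^sub>1 s 0 x))))"
    by (intro continuous_intros continuous_on_integral_parameter) (simp add: case_prod_unfold)
  fix x assume x: "x \<in> D"
  have "((\<lambda>s. E\<^sub>2 T s (P (E\<^sub>1 s 0 x))) has_integral (E\<^sub>2 T T (E\<^sub>1 T 0 x) - E\<^sub>2 T 0 (E\<^sub>1 0 0 x))) {0..T}"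
  proof (rule fundamental_theorem_of_calculus[OF T])
    fix s assume s: "s \<in> {0..T}"
    have D: "E\<^sub>1 s 0 x \<in> D"
      and d1: "((\<lambda>s. E\<^sub>1 s 0 x) has_vector_derivative B\<^sub>1 s (E\<^sub>1 s 0 x)) (at s within {0..T})"
      using gen1 x s by (auto simp: generates_evolution_system_def)
    have d2: "((\<lambda>\<sigma>. E\<^sub>2 T \<sigma> (E\<^sub>1 s 0 x)) has_vector_derivative
        - E\<^sub>2 T s (B\<^sub>1 s (E\<^sub>1 s 0 x) - P (E\<^sub>1 s 0 x))) (at s within {0..T})"
      using gen2 D s by (auto simp: generates_evolution_system_def)
    show "((\<lambda>s. E\<^sub>2 T s (E\<^sub>1 s 0 x)) has_vector_derivative E\<^sub>2 T s (P (E\<^sub>1 s 0 x))) (at s within {0..T})"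
      using has_vector_derivative_bounded_family_apply[OF bd2 c2 s d2 d1]
      by (simp add: blinfun.diff_right)
  qed
  moreover have "E\<^sub>2 T T = id_blinfun" "E\<^sub>1 0 0 = id_blinfun"
    using ev T by (auto simp: evolution_system_def)
  ultimately show "E\<^sub>1 T 0 x = E\<^sub>2 T 0 x + integral {0..T} (\<lambda>s. E\<^sub>2 T s (P (E\<^sub>1 s 0 x)))"
    by (simp add: integral_unique)
qed (intro continuous_intros)

section \<open>Energy estimates for the damped system\<close>

text \<open>
  A generator is the limit of linear difference quotients, hence linear on its domain.
\<close>

lemma generates_C0_semigroup_diff:
  assumes B: "generates_C0_semigroup D B" and xy: "x \<in> D" "y \<in> D"
  shows "B (x - y) = B x - B y"
proof -
  obtain S :: "real \<Rightarrow> 'a \<Rightarrow>\<^sub>L 'a" where S: "\<And>x y. ((\<lambda>h. (S h x - x) /\<^sub>R h) \<longlongrightarrow> y) (at_right 0)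
      \<longleftrightarrow> x \<in> D \<and> y = B x"
    using B unfolding generates_C0_semigroup_def by blast
  have "((\<lambda>h. (S h x - x) /\<^sub>R h - (S h y - y) /\<^sub>R h) \<longlongrightarrow> B x - B y) (at_right 0)"
    using xy S by (intro tendsto_diff) auto
  hence "((\<lambda>h. (S h (x - y) - (x - y)) /\<^sub>R h) \<longlongrightarrow> B x - B y) (at_right 0)"
    by (simp add: blinfun.diff_right algebra_simps)
  thus ?thesis using S by metis
qed

lemma damped_generator_inner_le:
  fixes C :: "'a::{real_inner, banach} \<Rightarrow>\<^sub>L 'b::{real_inner, banach}"
  assumes "weakly_detectable T D A C \<mu>" "t \<in> {0..T}" "x \<in> D"
  shows "(A t x - r *\<^sub>R adjoint C (C x)) \<bullet> x \<le> - (r - \<mu>) * (norm (C x))\<^sup>2"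
proof -
  have "A t x \<bullet> x \<le> \<mu> * (norm (C x))\<^sup>2" using assms by (simp add: weakly_detectable_def)
  moreover have "adjoint C (C x) \<bullet> x = (norm (C x))\<^sup>2"
    using adjoint_blinfun_works[of C x "C x"] by (simp add: inner_commute power2_norm_eq_inner)
  ultimately show ?thesis by (simp add: inner_diff_left algebra_simps)
qed

lemma damped_evolution_contraction:
  fixes C :: "'a::{real_inner, banach} \<Rightarrow>\<^sub>L 'b::{real_inner, banach}"
  assumes dense: "closure D = UNIV"
    and gen: "generates_evolution_system T D (\<lambda>t x. A t x - r *\<^sub>R adjoint C (C x)) E"
    and det: "weakly_detectable T D A C \<mu>" and "\<mu> \<le> r"
    and st: "0 \<le> s" "s \<le> t" "t \<le> T"
  shows "norm (E t s x) \<le> norm x"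
proof -
  have "(A t x - r *\<^sub>R adjoint C (C x)) \<bullet> x \<le> 0 * (norm x)\<^sup>2" if "t \<in> {0..T}" "x \<in> D" for t x
  proof -
    have "0 \<le> (r - \<mu>) * (norm (C x))\<^sup>2" using \<open>\<mu> \<le> r\<close> by simp
    thus ?thesis using damped_generator_inner_le[OF det that, of r] by linarith
  qed
  from evolution_system_growth_bound[OF gen dense order_refl this st] show ?thesis by simp
qed

lemma output_continuous:
  fixes C :: "'a::{real_inner, banach} \<Rightarrow>\<^sub>L 'b::{real_inner, banach}"
  assumes ev: "evolution_system T E" and bd: "\<And>t x. t \<in> {0..T} \<Longrightarrow> norm (E t 0 x) \<le> M * norm x"
  shows "continuous_on {0..T} (\<lambda>t. (norm (C (E t 0 x)))\<^sup>2)"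
    and "continuous_on UNIV (\<lambda>x. integral {0..T} (\<lambda>t. (norm (C (E t 0 x)))\<^sup>2))"
proof -
  note c = evolution_system_continuous(1)[OF ev]
  show "continuous_on {0..T} (\<lambda>t. (norm (C (E t 0 x)))\<^sup>2)"
    by (intro continuous_intros c)
  have "continuous_on (UNIV \<times> {0..T}) (\<lambda>p. (norm (C (E (snd p) 0 (fst p))))\<^sup>2)"
    by (intro continuous_intros
        continuous_on_bounded_family_compose[where G = "\<lambda>t. E t 0", OF bd c]) auto
  thus "continuous_on UNIV (\<lambda>x. integral {0..T} (\<lambda>t. (norm (C (E t 0 x)))\<^sup>2))"
    by (intro continuous_on_integral_parameter) (simp add: case_prod_unfold)
qed

text \<open>
  In the derivative of \<open>\<parallel>w\<parallel>\<^sup>2\<close>, weak detectability bounds the contribution of \<open>A\<close> by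
  \<open>2 \<mu> \<parallel>C w\<parallel>\<^sup>2\<close>, while the damping contributes \<open>- 2 r \<parallel>C w\<parallel>\<^sup>2\<close>. The net loss is the output energy
  up to a factor.
\<close>

lemma damped_output_energy:
  fixes C :: "'a::{real_inner, banach} \<Rightarrow>\<^sub>L 'b::{real_inner, banach}"
  assumes T: "0 \<le> T" and dense: "closure D = UNIV"
    and gen: "generates_evolution_system T D (\<lambda>t x. A t x - r *\<^sub>R adjoint C (C x)) E"
    and det: "weakly_detectable T D A C \<mu>" and "\<mu> \<le> r"
  shows "(norm (E T 0 x))\<^sup>2 + 2 * (r - \<mu>) * integral {0..T} (\<lambda>t. (norm (C (E t 0 x)))\<^sup>2)
    \<le> (norm x)\<^sup>2"
proof (rule le_on_dense[OF dense, where x = x and g = "\<lambda>x. (norm x)\<^sup>2" and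
      f = "\<lambda>x. (norm (E T 0 x))\<^sup>2 + 2 * (r - \<mu>) * integral {0..T} (\<lambda>t. (norm (C (E t 0 x)))\<^sup>2)"])
  have ev: "evolution_system T E" using gen by (simp add: generates_evolution_system_def)
  have bd: "norm (E t 0 x) \<le> 1 * norm x" if "t \<in> {0..T}" for t x
    using damped_evolution_contraction[OF dense gen det \<open>\<mu> \<le> r\<close>, of 0 t x] that by simp
  note cont = output_continuous[OF ev bd, of C]
  show "continuous_on UNIV (\<lambda>x. (norm (E T 0 x))\<^sup>2
      + 2 * (r - \<mu>) * integral {0..T} (\<lambda>t. (norm (C (E t 0 x)))\<^sup>2))"
    by (intro continuous_intros cont)
  fix x assume x: "x \<in> D"
  let ?I = "integral {0..T} (\<lambda>t. (norm (C (E t 0 x)))\<^sup>2)"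
  have "(norm (E T 0 x))\<^sup>2 - (norm (E 0 0 x))\<^sup>2
      \<le> integral {0..T} (\<lambda>t. - 2 * (r - \<mu>) * (norm (C (E t 0 x)))\<^sup>2)"
  proof (rule increment_le_integral[OF T])
    fix t assume t: "t \<in> {0..T}"
    have D: "E t 0 x \<in> D" and d: "((\<lambda>t. E t 0 x) has_vector_derivative
        A t (E t 0 x) - r *\<^sub>R adjoint C (C (E t 0 x))) (at t within {0..T})"
      using gen x t by (auto simp: generates_evolution_system_def)
    show "((\<lambda>t. (norm (E t 0 x))\<^sup>2) has_real_derivative
        2 * ((A t (E t 0 x) - r *\<^sub>R adjoint C (C (E t 0 x))) \<bullet> E t 0 x)) (at t within {0..T})"
      by (rule has_real_derivative_norm_square[OF d])
    show "2 * ((A t (E t 0 x) - r *\<^sub>R adjoint C (C (E t 0 x))) \<bullet> E t 0 x)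
        \<le> - 2 * (r - \<mu>) * (norm (C (E t 0 x)))\<^sup>2"
      using damped_generator_inner_le[OF det t D, of r] by (simp add: algebra_simps)
  qed (intro continuous_on_mult_left cont(1))
  also have "\<dots> = - 2 * (r - \<mu>) * ?I" by (rule integral_mult_right)
  also have "E 0 0 x = x" using ev T by (simp add: evolution_system_def)
  finally show "(norm (E T 0 x))\<^sup>2 + 2 * (r - \<mu>) * ?I \<le> (norm x)\<^sup>2"
    by (simp add: algebra_simps)
qed (intro continuous_intros)

lemma undamped_evolution_bound:
  fixes C :: "'a::{real_inner, banach} \<Rightarrow>\<^sub>L 'b::{real_inner, banach}"
  assumes dense: "closure D = UNIV" and gen: "generates_evolution_system T D A U"
    and det: "weakly_detectable T D A C \<mu>" and \<mu>: "0 \<le> \<mu>" and t: "t \<in> {0..T}"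
  shows "norm (U t 0 x) \<le> exp (\<mu> * (norm C)\<^sup>2 * T) * norm x"
proof -
  have "A t x \<bullet> x \<le> \<mu> * (norm C)\<^sup>2 * (norm x)\<^sup>2" if "t \<in> {0..T}" "x \<in> D" for t x
  proof -
    have "A t x \<bullet> x \<le> \<mu> * (norm (C x))\<^sup>2" using det that by (simp add: weakly_detectable_def)
    also have "\<dots> \<le> \<mu> * (norm C * norm x)\<^sup>2"
      using \<mu> by (intro mult_left_mono power_mono norm_blinfun) auto
    finally show ?thesis by (simp add: power_mult_distrib mult.assoc)
  qed
  hence "norm (U t 0 x) \<le> exp (\<mu> * (norm C)\<^sup>2 * (t - 0)) * norm x"
    using \<mu> t by (intro evolution_system_growth_bound[OF gen dense]) auto
  also have "\<dots> \<le> exp (\<mu> * (norm C)\<^sup>2 * T) * norm x"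
    using \<mu> t by (intro mult_right_mono) (auto intro!: mult_left_mono)
  finally show ?thesis .
qed

text \<open>
  The energy estimate controls the output along damped trajectories, but observability is defined
  by undamped ones. The difference \<open>e = U(\<cdot>, 0) x - E(\<cdot>, 0) x\<close> starts at \<open>0\<close> and solves
  \<open>e' = A e + r C\<^sup>* C w\<close> with \<open>w = E(\<cdot>, 0) x\<close>, so it is driven by the damped output alone; by weak
  detectability and Gronwall's inequality \<open>\<parallel>e\<parallel>\<^sup>2\<close> is bounded by the energy of that output.
\<close>

lemma undamped_output_le_damped_output:
  fixes C :: "'a::{real_inner, banach} \<Rightarrow>\<^sub>L 'b::{real_inner, banach}"
  assumes T: "0 \<le> T" and D: "subspace D" and dense: "closure D = UNIV"
    and diff: "\<And>t x y. t \<in> {0..T} \<Longrightarrow> x \<in> D \<Longrightarrow> y \<in> D \<Longrightarrow> A t (x - y) = A t x - A t y"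
    and genU: "generates_evolution_system T D A U"
    and genE: "generates_evolution_system T D (\<lambda>t x. A t x - r *\<^sub>R adjoint C (C x)) E"
    and det: "weakly_detectable T D A C \<mu>" and \<mu>: "0 \<le> \<mu>" and r: "\<mu> \<le> r"
  shows "\<exists>k. \<forall>x. integral {0..T} (\<lambda>t. (norm (C (U t 0 x)))\<^sup>2)
    \<le> k * integral {0..T} (\<lambda>t. (norm (C (E t 0 x)))\<^sup>2)"
proof -
  define K where "K = (2 * \<mu> + r) * (norm C)\<^sup>2"
  define m where "m = 2 * (norm C)\<^sup>2 * exp (K * T) * r"
  have K: "0 \<le> K" using \<mu> r by (simp add: K_def)
  have evU: "evolution_system T U" and evE: "evolution_system T E"
    using genU genE by (auto simp: generates_evolution_system_def)
  have bdE: "norm (E t 0 x) \<le> 1 * norm x" if "t \<in> {0..T}" for t x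
    using damped_evolution_contraction[OF dense genE det r, of 0 t x] that by simp
  note contU = output_continuous[OF evU undamped_evolution_bound[OF dense genU det \<mu>], of C]
  note contE = output_continuous[OF evE bdE, of C]
  have on_D: "integral {0..T} (\<lambda>t. (norm (C (U t 0 x)))\<^sup>2)
      \<le> (2 + T * m) * integral {0..T} (\<lambda>t. (norm (C (E t 0 x)))\<^sup>2)" if x: "x \<in> D" for x
  proof -
    let ?u = "\<lambda>t. U t 0 x" and ?w = "\<lambda>t. E t 0 x"
    let ?e = "\<lambda>t. ?u t - ?w t"
    let ?I = "integral {0..T} (\<lambda>t. (norm (C (?w t)))\<^sup>2)"
    have e_bound: "(norm (?e t))\<^sup>2 \<le> exp (K * T) * (r * ?I)" if t: "t \<in> {0..T}" for t
    proof -
      have sub: "{0..t} \<subseteq> {0..T}" using t by auto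
      have cw: "continuous_on {0..t} (\<lambda>s. r * (norm (C (?w s)))\<^sup>2)"
        using contE(1) sub by (intro continuous_on_mult_left) (rule continuous_on_subset)
      have "(norm (?e t))\<^sup>2 \<le> exp (K * (t - 0)) *
          ((norm (?e 0))\<^sup>2 + integral {0..t} (\<lambda>s. r * (norm (C (?w s)))\<^sup>2))"
      proof (rule gronwall_bound[OF _ K _ _ cw])
        fix s assume s: "s \<in> {0..t}"
        hence sT: "s \<in> {0..T}" using sub by auto
        have D': "?u s \<in> D" "?w s \<in> D" 
          and du: "(?u has_vector_derivative A s (?u s)) (at s within {0..T})"
          and dw: "(?w has_vector_derivative A s (?w s) - r *\<^sub>R adjoint C (C (?w s)))
              (at s within {0..T})"
          using genU genE x sT by (auto simp: generates_evolution_system_def)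
        have De: "?e s \<in> D" using D' by (rule subspace_diff[OF D])
        have Ae: "A s (?u s) - A s (?w s) = A s (?e s)" using diff[OF sT D'] by simp
        have "(?e has_vector_derivative
            A s (?u s) - (A s (?w s) - r *\<^sub>R adjoint C (C (?w s)))) (at s within {0..T})"
          by (rule has_vector_derivative_diff[OF du dw])
        also have "A s (?u s) - (A s (?w s) - r *\<^sub>R adjoint C (C (?w s)))
            = A s (?e s) + r *\<^sub>R adjoint C (C (?w s))" using Ae by simp
        finally have de: "(?e has_vector_derivative A s (?e s) + r *\<^sub>R adjoint C (C (?w s)))
            (at s within {0..t})"
          using sub by (rule has_vector_derivative_within_subset)
        show "((\<lambda>s. (norm (?e s))\<^sup>2) has_real_derivative
            2 * ((A s (?e s) + r *\<^sub>R adjoint C (C (?w s))) \<bullet> ?e s)) (at s within {0..t})"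
          by (rule has_real_derivative_norm_square[OF de])
        have adj: "adjoint C (C (?w s)) \<bullet> ?e s = C (?w s) \<bullet> C (?e s)"
          using adjoint_blinfun_works[of C "?e s" "C (?w s)"] by (simp only: inner_commute)
        have "2 * ((A s (?e s) + r *\<^sub>R adjoint C (C (?w s))) \<bullet> ?e s)
            = 2 * (A s (?e s) \<bullet> ?e s) + r * (2 * (C (?w s) \<bullet> C (?e s)))"
          by (simp only: inner_add_left inner_scaleR_left adj ring_distribs mult.left_commute)
        also have "\<dots> \<le> 2 * (\<mu> * (norm (C (?e s)))\<^sup>2)
            + r * ((norm (C (?w s)))\<^sup>2 + (norm (C (?e s)))\<^sup>2)"
        proof (intro add_mono mult_left_mono)
          show "A s (?e s) \<bullet> ?e s \<le> \<mu> * (norm (C (?e s)))\<^sup>2"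
            using det sT De unfolding weakly_detectable_def by blast
          have "0 \<le> (norm (C (?w s) - C (?e s)))\<^sup>2" by simp
          thus "2 * (C (?w s) \<bullet> C (?e s)) \<le> (norm (C (?w s)))\<^sup>2 + (norm (C (?e s)))\<^sup>2"
            unfolding power2_norm_eq_inner inner_diff_left inner_diff_right
            by (simp add: inner_commute)
        qed (use \<mu> r in auto)
        also have "\<dots> = (2 * \<mu> + r) * (norm (C (?e s)))\<^sup>2 + r * (norm (C (?w s)))\<^sup>2"
          by (simp add: algebra_simps)
        also have "\<dots> \<le> (2 * \<mu> + r) * (norm C * norm (?e s))\<^sup>2 + r * (norm (C (?w s)))\<^sup>2"
          using \<mu> r by (intro add_right_mono mult_left_mono power_mono norm_blinfun) auto
        finally show "2 * ((A s (?e s) + r *\<^sub>R adjoint C (C (?w s))) \<bullet> ?e s)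
            \<le> K * (norm (?e s))\<^sup>2 + r * (norm (C (?w s)))\<^sup>2"
          by (simp only: K_def power_mult_distrib mult.assoc)
      qed (use t \<mu> r in auto)
      also have "norm (?e 0) = 0" using evU evE T by (simp add: evolution_system_def)
      also have "exp (K * (t - 0)) * (0\<^sup>2 + integral {0..t} (\<lambda>s. r * (norm (C (?w s)))\<^sup>2))
          = exp (K * t) * (r * integral {0..t} (\<lambda>s. (norm (C (?w s)))\<^sup>2))" by simp
      also have "\<dots> \<le> exp (K * T) * (r * ?I)"
      proof -
        have int_t: "(\<lambda>s. (norm (C (?w s)))\<^sup>2) integrable_on {0..t}"
          by (rule integrable_continuous_interval[OF continuous_on_subset[OF contE(1) sub]])
        have int_T: "(\<lambda>s. (norm (C (?w s)))\<^sup>2) integrable_on {0..T}"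
          by (rule integrable_continuous_interval[OF contE(1)])
        have "integral {0..t} (\<lambda>s. (norm (C (?w s)))\<^sup>2) \<le> ?I"
          by (rule integral_subset_le[OF sub int_t int_T]) simp
        moreover have "0 \<le> integral {0..t} (\<lambda>s. (norm (C (?w s)))\<^sup>2)"
          by (rule integral_nonneg[OF int_t]) simp
        moreover have "exp (K * t) \<le> exp (K * T)" using K t by (simp add: mult_left_mono)
        ultimately show ?thesis using \<mu> r by (intro mult_mono) simp_all
      qed
      finally show ?thesis .
    qed
    have "integral {0..T} (\<lambda>t. (norm (C (?u t)))\<^sup>2)
        \<le> integral {0..T} (\<lambda>t. 2 * (norm (C (?w t)))\<^sup>2 + m * ?I)"
    proof (rule integral_le)
      show "(\<lambda>t. (norm (C (?u t)))\<^sup>2) integrable_on {0..T}"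
        by (intro integrable_continuous_interval contU)
      show "(\<lambda>t. 2 * (norm (C (?w t)))\<^sup>2 + m * ?I) integrable_on {0..T}"
        by (intro integrable_continuous_interval continuous_intros contE(1))
      fix t assume t: "t \<in> {0..T}"
      have "(norm (C (?u t)))\<^sup>2 = (norm (C (?w t) + C (?e t)))\<^sup>2" by (simp add: blinfun.diff_right)
      also have "\<dots> \<le> 2 * (norm (C (?w t)))\<^sup>2 + 2 * (norm (C (?e t)))\<^sup>2"
      proof -
        have "0 \<le> (norm (C (?w t) - C (?e t)))\<^sup>2" by simp
        thus ?thesis unfolding power2_norm_eq_inner inner_diff_left inner_diff_right
            inner_add_left inner_add_right by (simp add: inner_commute)
      qed
      also have "(norm (C (?e t)))\<^sup>2 \<le> (norm C * norm (?e t))\<^sup>2"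
        by (intro power_mono norm_blinfun) auto
      also have "(norm C * norm (?e t))\<^sup>2 \<le> (norm C)\<^sup>2 * (exp (K * T) * (r * ?I))"
        unfolding power_mult_distrib by (intro mult_left_mono e_bound[OF t]) simp
      finally show "(norm (C (?u t)))\<^sup>2 \<le> 2 * (norm (C (?w t)))\<^sup>2 + m * ?I"
        by (simp add: m_def mult.assoc)
    qed
    also have "\<dots> = 2 * ?I + T * (m * ?I)"
      using T by (subst integral_add)
        (auto intro!: integrable_continuous_interval continuous_intros contE(1))
    finally show ?thesis by (simp add: algebra_simps)
  qed
  show ?thesis
  proof (intro exI allI)
    fix x show "integral {0..T} (\<lambda>t. (norm (C (U t 0 x)))\<^sup>2)
      \<le> (2 + T * m) * integral {0..T} (\<lambda>t. (norm (C (E t 0 x)))\<^sup>2)"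
      by (rule le_on_dense[OF dense contU(2) continuous_on_mult_left[OF contE(2)] on_D])
  qed
qed

section \<open>Vanishing output implies weak convergence on the observable part\<close>

lemma integral_norm_square_zero_imp:
  fixes f :: "real \<Rightarrow> 'b::real_normed_vector"
  assumes "0 < T" "continuous_on {0..T} f" "integral {0..T} (\<lambda>t. (norm (f t))\<^sup>2) = 0" "t \<in> {0..T}"
  shows "f t = 0"
proof -
  have c: "continuous_on {0..T} (\<lambda>t. (norm (f t))\<^sup>2)" by (intro continuous_intros assms)
  have "((\<lambda>t. (norm (f t))\<^sup>2) has_integral 0) (cbox 0 T)"
    using integrable_integral[OF integrable_continuous_interval[OF c]] assms(3) by simp
  hence "(norm (f t))\<^sup>2 = 0"
    by (rule has_integral_0_cbox_imp_0[rotated 2]) (use assms c in auto)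
  thus ?thesis by simp
qed

text \<open>
  Let \<open>q\<close> be the output form \<open>q(x, y) = \<integral> \<langle>G x, G y\<rangle>\<close> and \<open>W y\<close> the Riesz representative of
  \<open>q(\<cdot>, y)\<close>, so that \<open>W\<close> is the Gramian in weak form. By the Cauchy-Schwarz inequality for \<open>q\<close>,
  \<open>\<langle>x\<^sub>n, W y\<rangle> = q(x\<^sub>n, y) \<rightarrow> 0\<close>. The set \<open>L\<close> of all \<open>v\<close> with \<open>\<langle>x\<^sub>n, v\<rangle> \<rightarrow> 0\<close> is a closed subspace, as
  the sequence is bounded, and it contains the range of \<open>W\<close>; hence anything orthogonal to \<open>L\<close> is
  unobservable, and \<open>L\<close> contains every \<open>v\<close> that is orthogonal to the unobservable vectors.
\<close>

lemma weak_limit_on_observable_part: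
  fixes G :: "real \<Rightarrow> 'a::{real_inner, banach} \<Rightarrow>\<^sub>L 'b::real_inner" and x :: "nat \<Rightarrow> 'a"
  assumes T: "0 < T"
    and bd: "\<And>t x. t \<in> {0..T} \<Longrightarrow> norm (G t x) \<le> M * norm x"
    and cont: "\<And>x. continuous_on {0..T} (\<lambda>t. G t x)"
    and bounded: "\<And>n. norm (x n) \<le> R"
    and lim: "(\<lambda>n. integral {0..T} (\<lambda>t. (norm (G t (x n)))\<^sup>2)) \<longlonglongrightarrow> 0"
    and v: "v \<in> {x. \<forall>t\<in>{0..T}. G t x = 0}\<^sup>\<bottom>"
  shows "(\<lambda>n. x n \<bullet> v) \<longlonglongrightarrow> 0"
proof -
  define q where "q = (\<lambda>x y. integral {0..T} (\<lambda>t. G t x \<bullet> G t y))"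
  have c: "continuous_on {0..T} (\<lambda>t. G t x \<bullet> G t y)" for x y
    by (intro continuous_intros cont)
  note int = integrable_continuous_interval[OF c]
  have q_self: "q y y = integral {0..T} (\<lambda>t. (norm (G t y))\<^sup>2)" for y
    by (simp add: q_def power2_norm_eq_inner)
  have q_pos: "0 \<le> q y y" for y
    unfolding q_def by (intro integral_nonneg int) simp
  have q_null: "G t y = 0" if "q y y = 0" "t \<in> {0..T}" for t y
    using integral_norm_square_zero_imp[OF T cont _ that(2)] that(1) by (simp add: q_self)
  have q_add: "q (x + x') y = q x y + q x' y" for x x' y
    unfolding q_def using int by (simp add: blinfun.add_right inner_add_left integral_add)
  have q_scale: "q (a *\<^sub>R x) y = a * q x y" for a x y
    unfolding q_def by (simp add: blinfun.scaleR_right)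
  have q_commute: "q x y = q y x" for x y
    unfolding q_def by (simp add: inner_commute)
  have q_lin: "bounded_linear (\<lambda>x. q x y)" for y
  proof (rule bounded_linear_intro)
    fix x
    have "norm (G t x \<bullet> G t y) \<le> (M * norm x) * (M * norm y)" if t: "t \<in> {0..T}" for t
    proof -
      have "norm (G t x \<bullet> G t y) \<le> norm (G t x) * norm (G t y)" by (simp add: Cauchy_Schwarz_ineq2)
      also have "\<dots> \<le> (M * norm x) * (M * norm y)"
        using bd[OF t] by (intro mult_mono) (auto intro: order_trans[OF norm_ge_zero])
      finally show ?thesis .
    qed
    hence "norm (q x y) \<le> (M * norm x) * (M * norm y) * (T - 0)"
      unfolding q_def using T by (intro integral_bound c) auto
    thus "norm (q x y) \<le> norm x * (M * M * norm y * T)" by (simp add: algebra_simps)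
  qed (simp_all add: q_add q_scale)
  have q_cs: "(q x y)\<^sup>2 \<le> q x x * q y y" for x y
  proof (cases "q y y = 0")
    case True
    have "q x y = integral {0..T} (\<lambda>t. 0)"
      unfolding q_def using q_null[OF True] by (intro integral_cong) simp
    thus ?thesis using True by simp
  next
    case False
    \<comment> \<open>The vector \<open>a x + b y\<close> is \<open>q(y, y)\<close> times the component of \<open>x\<close> that is \<open>q\<close>-orthogonal to \<open>y\<close>.\<close>
    define a b where "a = q y y" and "b = - q x y"
    have "q (a *\<^sub>R x + b *\<^sub>R y) (a *\<^sub>R x + b *\<^sub>R y)
        = a * a * q x x + 2 * a * b * q x y + b * b * q y y"
      using q_commute[of x "a *\<^sub>R x + b *\<^sub>R y"] q_commute[of y "a *\<^sub>R x + b *\<^sub>R y"] q_commute[of x y]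
      by (simp add: q_add q_scale algebra_simps)
    also have "\<dots> = q y y * (q x x * q y y - (q x y)\<^sup>2)"
      by (simp add: a_def b_def power2_eq_square algebra_simps)
    finally have "0 \<le> q y y * (q x x * q y y - (q x y)\<^sup>2)" using q_pos by metis
    thus ?thesis using False q_pos[of y] by (simp add: zero_le_mult_iff)
  qed
  have "\<forall>y. \<exists>w. \<forall>x. q x y = x \<bullet> w" using riesz_representation[OF q_lin] by blast
  then obtain W where W: "\<And>x y. q x y = x \<bullet> W y" by metis
  define L where "L = {v. (\<lambda>n. x n \<bullet> v) \<longlonglongrightarrow> 0}"
  have W_L: "W y \<in> L" for y
  proof -
    have "(\<lambda>n. q (x n) (x n) * q y y) \<longlonglongrightarrow> 0"
      using lim by (intro tendsto_mult_left_zero) (simp add: q_self)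
    hence "(\<lambda>n. (q (x n) y)\<^sup>2) \<longlonglongrightarrow> 0"
      by (rule Lim_null_comparison[rotated]) (simp add: q_cs)
    thus ?thesis by (simp add: L_def W)
  qed
  have R: "0 \<le> R" using bounded[of 0] norm_ge_zero[of "x 0"] by linarith
  have "subspace L"
    unfolding subspace_def L_def
    by (auto simp: inner_add_right intro: tendsto_add_zero tendsto_mult_right_zero)
  moreover have "closed L"
  proof -
    have "u \<in> L" if u: "u \<in> closure L" for u
      unfolding L_def mem_Collect_eq
    proof (rule LIMSEQ_I)
      fix e :: real assume e: "0 < e"
      have "0 < e / (2 * (R + 1))" using e R by simp
      then obtain u' where u': "u' \<in> L" "norm (u' - u) < e / (2 * (R + 1))"
        using u unfolding closure_approachable dist_norm by blast
      obtain N where N: "\<And>n. n \<ge> N \<Longrightarrow> norm (x n \<bullet> u' - 0) < e / 2"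
        using LIMSEQ_D[of "\<lambda>n. x n \<bullet> u'" 0 "e / 2"] u'(1) e unfolding L_def by auto
      have "norm (x n \<bullet> u - 0) < e" if n: "n \<ge> N" for n
      proof -
        have "\<bar>x n \<bullet> (u' - u)\<bar> \<le> norm (x n) * norm (u' - u)" by (rule Cauchy_Schwarz_ineq2)
        also have "\<dots> \<le> (R + 1) * (e / (2 * (R + 1)))"
          using bounded[of n] u'(2) R by (intro mult_mono) auto
        also have "\<dots> = e / 2" using R by (simp add: field_simps)
        finally show ?thesis using N[OF n] unfolding real_norm_def inner_diff_right by linarith
      qed
      thus "\<exists>N. \<forall>n\<ge>N. norm (x n \<bullet> u - 0) < e" by blast
    qed
    thus ?thesis using closure_subset_eq by blast
  qed
  \<comment> \<open>The component \<open>v - p\<close> orthogonal to \<open>L\<close> is unobservable, so it is orthogonal to \<open>v\<close> as well as to \<open>p\<close>.\<close>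
  ultimately obtain p where p: "p \<in> L" "v - p \<in> L\<^sup>\<bottom>" using ex_orthogonal_decomposition by blast
  have orth: "y \<bullet> (v - p) = 0" if "y \<in> L" for y
    using p(2) that unfolding orthogonal_comp_def orthogonal_def by blast
  have "q (v - p) (v - p) = 0"
    using orth[OF W_L] by (metis W inner_commute)
  hence "(v - p) \<bullet> v = 0"
    using v q_null unfolding orthogonal_comp_def orthogonal_def by blast
  moreover have "(v - p) \<bullet> p = 0" using orth[OF p(1)] by (simp add: inner_commute)
  ultimately have "(v - p) \<bullet> (v - p) = 0" by (simp add: inner_diff_right)
  hence "v = p" by simp
  thus ?thesis using p(1) by (simp add: L_def)
qed

text \<open>
  If the output of \<open>x\<close> vanishes, then the Gramian integrand at \<open>x\<close> is identically \<open>0\<close>, so \<open>x\<close> lies in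
  the kernel of the Gramian even if the integrand at other vectors fails to be integrable in norm.
\<close>

lemma observable_subspace_subset:
  fixes C :: "'a::{real_inner, banach} \<Rightarrow>\<^sub>L 'b::{real_inner, banach}"
  shows "observable_subspace T U C \<subseteq> {x. \<forall>t\<in>{0..T}. (C o\<^sub>L U t 0) x = 0}\<^sup>\<bottom>"
  unfolding observable_subspace_def
proof (rule orthogonal_comp_anti_mono, safe)
  fix x assume x: "\<forall>t\<in>{0..T}. (C o\<^sub>L U t 0) x = 0"
  have "observability_gramian T U C x = integral {0..T} (\<lambda>t. 0)"
    unfolding observability_gramian_def using x
    by (intro integral_cong) (simp add: adjoint_blinfun_zero)
  thus "observability_gramian T U C x = 0" by simp
qed

section \<open>The error of back and forth nudging\<close>

lemma damped_variation_of_constants: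
  fixes C :: "'a::{real_inner, banach} \<Rightarrow>\<^sub>L 'b::{real_inner, banach}"
  assumes T: "0 \<le> T" and dense: "closure D = UNIV"
    and genU: "generates_evolution_system T D A U"
    and genE: "generates_evolution_system T D (\<lambda>t x. A t x - r *\<^sub>R adjoint C (C x)) E"
    and det: "weakly_detectable T D A C \<mu>" and \<mu>: "0 \<le> \<mu>" and r: "\<mu> \<le> r"
  shows "U T 0 x = E T 0 x + integral {0..T} (\<lambda>s. E T s (r *\<^sub>R adjoint C (C (U s 0 x))))"
proof (rule duhamel_formula[OF T dense genU genE])
  show "bounded_linear (\<lambda>x. r *\<^sub>R adjoint C (C x))"
    by (intro bounded_linear_scaleR_right[THEN bounded_linear_compose]
        bounded_linear_compose[OF bounded_linear_adjoint_blinfun] blinfun.bounded_linear_right)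
  show "norm (U t 0 x) \<le> exp (\<mu> * (norm C)\<^sup>2 * T) * norm x" if "t \<in> {0..T}" for t x
    by (rule undamped_evolution_bound[OF dense genU det \<mu> that])
  show "norm (E T s x) \<le> 1 * norm x" if "s \<in> {0..T}" for s x
    using damped_evolution_contraction[OF dense genE det r, of s T x] that by simp
qed

text \<open>
  Over one pass, the observed trajectory and the observer solve the same damped equation with the
  same forcing term \<open>r C\<^sup>* C z\<close>; for the observed trajectory this is the variation of constants
  formula. The forcing cancels in the difference. The backward pass is a forward pass of the
  time-reversed family \<open>- A (T - t)\<close>.
\<close>

lemma nudging_error_iteration:
  fixes C :: "'a::{real_inner, banach} \<Rightarrow>\<^sub>L 'b::{real_inner, banach}"
  assumes T: "0 < T" and dense: "closure D = UNIV"
    and U: "generates_bidirectional T D A U"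
    and Sp: "generates_evolution_system T D (\<lambda>t x. A t x - r *\<^sub>R adjoint C (C x)) S\<^sub>p"
    and Sm: "generates_evolution_system T D (\<lambda>t x. - A (T - t) x - r *\<^sub>R adjoint C (C x))
        (\<lambda>t s. S\<^sub>m (T - t) (T - s))"
    and \<mu>: "0 \<le> \<mu>" and r: "\<mu> \<le> r"
    and det_fwd: "weakly_detectable T D A C \<mu>"
    and det_bwd: "weakly_detectable T D (\<lambda>t x. - A (T - t) x) C \<mu>"
    and nudging: "back_and_forth_nudging T U S\<^sub>p S\<^sub>m C r z zh"
  shows "zh (2 * n) 0 - z 0 = (blinfun_apply (S\<^sub>m 0 T o\<^sub>L S\<^sub>p T 0) ^^ n) (zh 0 0 - z 0)"
proof (induction n)
  case (Suc n)
  have T0: "0 \<le> T" "0 \<in> {0..T}" "T \<in> {0..T}" using T by auto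
  have bi: "bidirectional_evolution_system T U" and genU: "generates_evolution_system T D A U"
    and genU': "generates_evolution_system T D (\<lambda>t x. - A (T - t) x) (\<lambda>t s. U (T - t) (T - s))"
    using U by (auto simp: generates_bidirectional_def)
  let ?f = "\<lambda>t. r *\<^sub>R adjoint C (C (z t))"
  have z_mild: "mild_solution T U (\<lambda>t. 0) 0 z"
    and fwd: "mild_solution T S\<^sub>p ?f 0 (zh (2 * n))"
    and bwd: "mild_solution T S\<^sub>m (\<lambda>t. - ?f t) T (zh (2 * n + 1))"
    and joinT: "zh (2 * n + 1) T = zh (2 * n) T"
    and join: "\<forall>m\<ge>1. zh (2 * m) 0 = zh (2 * m - 1) 0"
    using nudging by (simp_all add: back_and_forth_nudging_def Let_def)
  have join0: "zh (2 * Suc n) 0 = zh (2 * n + 1) 0" using join[rule_format, of "Suc n"] by simp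
  have z: "z t = U t 0 (z 0)" if "t \<in> {0..T}" for t
    using bspec[OF z_mild[unfolded mild_solution_def] that] that by simp
  \<comment> \<open>The two-sided evolution law lets the observed trajectory be read from its final value.\<close>
  have zT: "z t = U t T (z T)" if "t \<in> {0..T}" for t
  proof -
    have "U t T o\<^sub>L U T 0 = U t 0"
      using bi that T0 by (simp add: bidirectional_evolution_system_def)
    thus ?thesis using z[OF that] z[OF T0(3)] by (metis blinfun_apply_blinfun_compose)
  qed
  have "zh (2 * n) T = S\<^sub>p T 0 (zh (2 * n) 0) + integral {0..T} (\<lambda>s. S\<^sub>p T s (?f s))"
    using bspec[OF fwd[unfolded mild_solution_def] T0(3)] T0(1) by simp
  moreover have "z T = S\<^sub>p T 0 (z 0) + integral {0..T} (\<lambda>s. S\<^sub>p T s (?f s))"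
  proof -
    have "z T = S\<^sub>p T 0 (z 0)
        + integral {0..T} (\<lambda>s. S\<^sub>p T s (r *\<^sub>R adjoint C (C (U s 0 (z 0)))))"
      using damped_variation_of_constants[OF T0(1) dense genU Sp det_fwd \<mu> r, of "z 0"]
        z[OF T0(3)] by simp
    also have "integral {0..T} (\<lambda>s. S\<^sub>p T s (r *\<^sub>R adjoint C (C (U s 0 (z 0)))))
        = integral {0..T} (\<lambda>s. S\<^sub>p T s (?f s))"
      by (intro integral_cong) (simp flip: z)
    finally show ?thesis .
  qed
  ultimately have step_fwd: "zh (2 * n) T - z T = S\<^sub>p T 0 (zh (2 * n) 0 - z 0)"
    by (simp add: blinfun.diff_right)
  have "zh (2 * n + 1) 0
      = S\<^sub>m 0 T (zh (2 * n + 1) T) + integral {0..T} (\<lambda>s. S\<^sub>m 0 s (?f s))"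
    using bspec[OF bwd[unfolded mild_solution_def] T0(2)] T by (simp add: blinfun.minus_right)
  moreover have "z 0 = S\<^sub>m 0 T (z T) + integral {0..T} (\<lambda>s. S\<^sub>m 0 s (?f s))"
  proof -
    have "z 0 = S\<^sub>m 0 T (z T)
        + integral {0..T} (\<lambda>s. S\<^sub>m 0 (T - s) (r *\<^sub>R adjoint C (C (U (T - s) T (z T)))))"
      using damped_variation_of_constants[OF T0(1) dense genU' Sm det_bwd \<mu> r, of "z T"]
        zT[OF T0(2)] by simp
    also have "integral {0..T}
          (\<lambda>s. S\<^sub>m 0 (T - s) (r *\<^sub>R adjoint C (C (U (T - s) T (z T)))))
        = integral {0..T} (\<lambda>s. S\<^sub>m 0 (T - s) (?f (T - s)))"
      by (intro integral_cong) (simp flip: zT)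
    also have "\<dots> = integral {0..T} (\<lambda>s. S\<^sub>m 0 s (?f s))"
      by (rule integral_reverse_interval)
    finally show ?thesis .
  qed
  ultimately have "zh (2 * n + 1) 0 - z 0 = S\<^sub>m 0 T (zh (2 * n) T - z T)"
    using joinT by (simp add: blinfun.diff_right)
  thus ?case using Suc.IH join0 step_fwd by simp
qed simp

text \<open>
  Along the iterates \<open>\<parallel>e\<^sub>n\<parallel>\<^sup>2\<close> is nonincreasing, hence convergent, and each forward pass lowers it by
  at least \<open>2 (r - \<mu>)\<close> times the damped output energy. So the damped output energies tend to \<open>0\<close>, then
  so do the undamped ones, and the previous section applies.
\<close>

lemma power_iteration_weakly_converges:
  fixes C :: "'a::{real_inner, banach} \<Rightarrow>\<^sub>L 'b::{real_inner, banach}" and R :: "'a \<Rightarrow>\<^sub>L 'a"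
  assumes T: "0 < T" and D: "subspace D" and dense: "closure D = UNIV"
    and diff: "\<And>t x y. t \<in> {0..T} \<Longrightarrow> x \<in> D \<Longrightarrow> y \<in> D \<Longrightarrow> A t (x - y) = A t x - A t y"
    and genU: "generates_evolution_system T D A U"
    and genE: "generates_evolution_system T D (\<lambda>t x. A t x - r *\<^sub>R adjoint C (C x)) E"
    and det: "weakly_detectable T D A C \<mu>" and \<mu>: "0 \<le> \<mu>" and r: "\<mu> < r"
    and contr: "\<And>x. norm (R x) \<le> norm x"
    and v: "v \<in> observable_subspace T U C"
  shows "(\<lambda>n. (blinfun_apply (R o\<^sub>L E T 0) ^^ n) x \<bullet> v) \<longlonglongrightarrow> 0"
proof -
  define e where "e = (\<lambda>n. (blinfun_apply (R o\<^sub>L E T 0) ^^ n) x)"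
  define I where "I = (\<lambda>n. integral {0..T} (\<lambda>t. (norm (C (E t 0 (e n))))\<^sup>2))"
  have T0: "0 \<le> T" and r': "\<mu> \<le> r" using T r by auto
  have evU: "evolution_system T U" and evE: "evolution_system T E"
    using genU genE by (auto simp: generates_evolution_system_def)
  have bdU: "norm (U t 0 x) \<le> exp (\<mu> * (norm C)\<^sup>2 * T) * norm x" if "t \<in> {0..T}" for t x
    by (rule undamped_evolution_bound[OF dense genU det \<mu> that])
  have bdE: "norm (E t 0 x) \<le> 1 * norm x" if "t \<in> {0..T}" for t x
    using damped_evolution_contraction[OF dense genE det r', of 0 t x] that by simp
  have I_pos: "0 \<le> I n" for n
    unfolding I_def
    by (intro integral_nonneg integrable_continuous_interval output_continuous(1)[OF evE bdE]) auto
  have step: "(norm (e (Suc n)))\<^sup>2 + 2 * (r - \<mu>) * I n \<le> (norm (e n))\<^sup>2" for n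
  proof -
    have "(norm (e (Suc n)))\<^sup>2 \<le> (norm (E T 0 (e n)))\<^sup>2"
      unfolding e_def by (intro power_mono) (auto intro: contr)
    thus ?thesis
      using damped_output_energy[OF T0 dense genE det r', of "e n"]
      unfolding I_def by linarith
  qed
  have "decseq (\<lambda>n. (norm (e n))\<^sup>2)"
  proof (rule decseq_SucI)
    fix n
    have "0 \<le> 2 * (r - \<mu>) * I n" using r I_pos by simp
    thus "(norm (e (Suc n)))\<^sup>2 \<le> (norm (e n))\<^sup>2" using step[of n] by linarith
  qed
  then obtain l where l: "(\<lambda>n. (norm (e n))\<^sup>2) \<longlonglongrightarrow> l"
    using decseq_convergent[of "\<lambda>n. (norm (e n))\<^sup>2" 0] by auto
  have e_bounded: "norm (e n) \<le> norm (e 0)" for n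
    using \<open>decseq _\<close>[THEN decseqD, of 0 n] by simp
  have "(\<lambda>n. ((norm (e n))\<^sup>2 - (norm (e (Suc n)))\<^sup>2) / (2 * (r - \<mu>)))
      \<longlonglongrightarrow> (l - l) / (2 * (r - \<mu>))"
    using l r by (intro tendsto_intros LIMSEQ_Suc[OF l]) auto
  hence "(\<lambda>n. ((norm (e n))\<^sup>2 - (norm (e (Suc n)))\<^sup>2) / (2 * (r - \<mu>))) \<longlonglongrightarrow> 0" by simp
  moreover have "I n \<le> ((norm (e n))\<^sup>2 - (norm (e (Suc n)))\<^sup>2) / (2 * (r - \<mu>))" for n
    using step[of n] r by (simp add: pos_le_divide_eq algebra_simps)
  ultimately have I_lim: "I \<longlonglongrightarrow> 0"
    using I_pos by (intro Lim_null_comparison[where f = I]) auto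
  obtain k where k: "\<And>x. integral {0..T} (\<lambda>t. (norm (C (U t 0 x)))\<^sup>2)
      \<le> k * integral {0..T} (\<lambda>t. (norm (C (E t 0 x)))\<^sup>2)"
    using undamped_output_le_damped_output[OF T0 D dense diff genU genE det \<mu> r'] by blast
  have J_pos: "0 \<le> integral {0..T} (\<lambda>t. (norm (C (U t 0 x)))\<^sup>2)" for x
    by (intro integral_nonneg integrable_continuous_interval output_continuous(1)[OF evU bdU]) auto
  have "(\<lambda>n. integral {0..T} (\<lambda>t. (norm (C (U t 0 (e n))))\<^sup>2)) \<longlonglongrightarrow> 0"
  proof (rule Lim_null_comparison)
    show "\<forall>\<^sub>F n in sequentially. norm (integral {0..T} (\<lambda>t. (norm (C (U t 0 (e n))))\<^sup>2)) \<le> k * I n"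
      using k J_pos by (simp add: I_def)
    show "(\<lambda>n. k * I n) \<longlonglongrightarrow> 0" using I_lim by (rule tendsto_mult_right_zero)
  qed
  moreover have "norm ((C o\<^sub>L U t 0) x) \<le> norm C * exp (\<mu> * (norm C)\<^sup>2 * T) * norm x"
    if t: "t \<in> {0..T}" for t x
  proof -
    have "norm ((C o\<^sub>L U t 0) x) \<le> norm C * norm (U t 0 x)" by (simp add: norm_blinfun)
    also have "\<dots> \<le> norm C * (exp (\<mu> * (norm C)\<^sup>2 * T) * norm x)"
      by (intro mult_left_mono bdU[OF t]) simp
    finally show ?thesis by (simp add: mult.assoc)
  qed
  moreover have "continuous_on {0..T} (\<lambda>t. (C o\<^sub>L U t 0) x)" for x
    unfolding blinfun_apply_blinfun_compose
    by (intro continuous_intros evolution_system_continuous(1)[OF evU])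
  ultimately have "(\<lambda>n. e n \<bullet> v) \<longlonglongrightarrow> 0"
    using v observable_subspace_subset[of T U C] e_bounded
    by (intro weak_limit_on_observable_part[where G = "\<lambda>t. C o\<^sub>L U t 0" and T = T]) (auto simp: T)
  thus ?thesis by (simp add: e_def)
qed

theorem theorem3p7:
  fixes T r \<mu> :: real
    and D :: "'a::{real_inner, banach} set"
    and A :: "real \<Rightarrow> 'a \<Rightarrow> 'a"
    and C :: "'a \<Rightarrow>\<^sub>L 'b::{real_inner, banach}"
    and U S\<^sub>p S\<^sub>m :: "real \<Rightarrow> real \<Rightarrow> 'a \<Rightarrow>\<^sub>L 'a"
  assumes "0 < T"
    and "standing_assumptions T D A"
    and "generates_bidirectional T D A U"
    and "generates_bidirectional T D (\<lambda>t x. A t x - r *\<^sub>R adjoint C (C x)) S\<^sub>p"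
    and "generates_bidirectional T D (\<lambda>t x. A t x + r *\<^sub>R adjoint C (C x)) S\<^sub>m"
    and "0 \<le> \<mu>"
    and "weakly_detectable T D A C \<mu>"
    and "weakly_detectable T D (\<lambda>t x. - A t x) C \<mu>"
    and "\<mu> < r"
  shows "weak_back_and_forth_observer T U S\<^sub>p S\<^sub>m C r (observable_subspace T U C) \<and>
    (\<forall>z zh. back_and_forth_nudging T U S\<^sub>p S\<^sub>m C r z zh \<longrightarrow>
       (\<forall>n. orthogonal_projection (observable_subspace T U C) (zh (2 * n) 0 - z 0) =
              orthogonal_projection (observable_subspace T U C) ((blinfun_apply (S\<^sub>m 0 T o\<^sub>L S\<^sub>p T 0) ^^ n) (zh 0 0 - z 0)))) \<and>
    (\<forall>\<epsilon>\<^sub>0. weakly_converges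
       (\<lambda>n. orthogonal_projection (observable_subspace T U C) ((blinfun_apply (S\<^sub>m 0 T o\<^sub>L S\<^sub>p T 0) ^^ n) \<epsilon>\<^sub>0)) 0)"
proof -
  have dense: "closure D = UNIV" and D: "subspace D"
    using assms(2) by (auto simp: standing_assumptions_def)
  have diff: "A t (x - y) = A t x - A t y" if "t \<in> {0..T}" "x \<in> D" "y \<in> D" for t x y
    using assms(2) that by (intro generates_C0_semigroup_diff) (auto simp: standing_assumptions_def)
  have genU: "generates_evolution_system T D A U"
    and Sp: "generates_evolution_system T D (\<lambda>t x. A t x - r *\<^sub>R adjoint C (C x)) S\<^sub>p"
    using assms(3,4) by (auto simp: generates_bidirectional_def)
  have Sm: "generates_evolution_system T D (\<lambda>t x. - A (T - t) x - r *\<^sub>R adjoint C (C x))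
      (\<lambda>t s. S\<^sub>m (T - t) (T - s))"
    using assms(5) by (simp add: generates_bidirectional_def)
  have det_bwd: "weakly_detectable T D (\<lambda>t x. - A (T - t) x) C \<mu>"
    unfolding weakly_detectable_def
  proof (intro ballI)
    fix t x assume "t \<in> {0..T}" "x \<in> D"
    moreover from this have "T - t \<in> {0..T}" by auto
    ultimately show "- A (T - t) x \<bullet> x \<le> \<mu> * (norm (C x))\<^sup>2"
      using assms(8) unfolding weakly_detectable_def by blast
  qed
  have r: "\<mu> \<le> r" using assms(9) by simp
  have contr: "norm (S\<^sub>m 0 T x) \<le> norm x" for x
    using damped_evolution_contraction[OF dense Sm det_bwd r, of 0 T x] assms(1) by simp
  let ?V = "observable_subspace T U C" and ?S = "blinfun_apply (S\<^sub>m 0 T o\<^sub>L S\<^sub>p T 0)"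
  have V: "subspace ?V" "closed ?V"
    by (simp_all add: observable_subspace_def subspace_orthogonal_comp closed_orthogonal_comp)
  have error: "zh (2 * n) 0 - z 0 = (?S ^^ n) (zh 0 0 - z 0)"
    if "back_and_forth_nudging T U S\<^sub>p S\<^sub>m C r z zh" for z zh n
    by (rule nudging_error_iteration[OF assms(1) dense assms(3) Sp Sm assms(6) r assms(7) det_bwd that])
  have conv: "weakly_converges (\<lambda>n. orthogonal_projection ?V ((?S ^^ n) \<epsilon>)) 0" for \<epsilon>
    unfolding weakly_converges_def
  proof
    fix \<phi> :: "'a \<Rightarrow>\<^sub>L real"
    obtain v where v: "\<And>x. \<phi> x = x \<bullet> v"
      using riesz_representation[OF blinfun.bounded_linear_right[of \<phi>]] by blast
    have "(\<lambda>n. (?S ^^ n) \<epsilon> \<bullet> orthogonal_projection ?V v) \<longlonglongrightarrow> 0"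
      using orthogonal_projection_works[OF V]
      by (intro power_iteration_weakly_converges[OF assms(1) D dense diff genU Sp assms(7,6,9) contr])
        auto
    thus "(\<lambda>n. \<phi> (orthogonal_projection ?V ((?S ^^ n) \<epsilon>))) \<longlonglongrightarrow> \<phi> 0"
      by (simp add: v orthogonal_projection_self_adjoint[OF V])
  qed
  show ?thesis
    unfolding weak_back_and_forth_observer_def using error conv by auto
qed

end
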